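(* Let $0<\lambda\le\Lambda$. There exist constants $\eta>2$, $0<\epsilon<1$ and $M>1$, depending only on $\lambda,\Lambda$, such that the following holds for every operator $L=a_{11}X_1^2+2a_{12}X_2X_1+a_{22}X_2^2$ with ellipticity constants $\lambda,\Lambda$, every $y\in\mathbb{R}^2$ and every $r>0$: if $u\in C^2(B(y,\eta r))\cap C(\overline{B(y,\eta r)})$ is nonnegative, satisfies $Lu\le 0$ in $B(y,\eta r)$, and $\inf_{B(y,r)\cap B(y,\eta r)}u\le 1$, then for every $k\in\mathbb{N}$ $$\left|\{u\ge M^k\}\cap B(y,r/2)\cap B(y,\eta r)\right|\le\epsilon^k\,|B(y,r/2)\cap B(y,\eta r)|,$$ where $|\cdot|$ is Lebesgue measure.
   Context: On $\mathbb{R}^2$ with points $x=(x_1,x_2)$, let $X_1=\partial_{x_1}$ and $X_2=x_1\partial_{x_2}$ (Grushin vector fields). The operator is $L=a_{11}X_1^2+2a_{12}X_2X_1+a_{22}X_2^2$, i.e. $Lu=a_{11}u_{x_1x_1}+2a_{12}X_2X_1u+a_{22}X_2^2u$ with $X_2X_1u=x_1u_{x_1x_2}$ and $X_2^2u=x_1^2u_{x_2x_2}$, where $a_{11},a_{12},a_{22}$ are measurable real functions on $\mathbb{R}^2$ such that at every point $\lambda(\xi_1^2+\xi_2^2)\le a_{11}\xi_1^2+2a_{12}\xi_1\xi_2+a_{22}\xi_2^2\le\Lambda(\xi_1^2+\xi_2^2)$ for all $\xi\in\mathbb{R}^2$; then $\lambda,\Lambda$ are called ellipticity constants of $L$. For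 $x,y\in\mathbb{R}^2$ put $\tilde d(x,y)=|x_1-y_1|+\sqrt{x_1^2+y_1^2+4|x_2-y_2|}-\sqrt{x_1^2+y_1^2}$, and let $B(y,r)=\{x\in\mathbb{R}^2:\tilde d(x,y)<r\}$. *)

theory Defs
  imports "HOL-Analysis.Analysis"
begin

definition pd1 :: "(real \<times> real \<Rightarrow> real) \<Rightarrow> real \<times> real \<Rightarrow> real" where
  "pd1 f x = deriv (\<lambda>t. f (t, snd x)) (fst x)"

definition pd2 :: "(real \<times> real \<Rightarrow> real) \<Rightarrow> real \<times> real \<Rightarrow> real" where
  "pd2 f x = deriv (\<lambda>t. f (fst x, t)) (snd x)"

text \<open>\<open>deriv\<close> is total, so existence of the partial derivatives has to be required
  explicitly. Both notions below are meant for open \<open>U\<close>: the partial derivatives at a point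
  of \<open>U\<close> are two-sided and depend only on the values of \<open>f\<close> on \<open>U\<close>.\<close>

definition C1_on :: "(real \<times> real) set \<Rightarrow> (real \<times> real \<Rightarrow> real) \<Rightarrow> bool" where
  "C1_on U f \<longleftrightarrow>
     (\<forall>x\<in>U. (\<lambda>t. f (t, snd x)) field_differentiable (at (fst x)) \<and>
            (\<lambda>t. f (fst x, t)) field_differentiable (at (snd x))) \<and>
     continuous_on U (pd1 f) \<and> continuous_on U (pd2 f)"

definition C2_on :: "(real \<times> real) set \<Rightarrow> (real \<times> real \<Rightarrow> real) \<Rightarrow> bool" where
  "C2_on U f \<longleftrightarrow> C1_on U f \<and> C1_on U (pd1 f) \<and> C1_on U (pd2 f)"

definition X1 :: "(real \<times> real \<Rightarrow> real) \<Rightarrow> real \<times> real \<Rightarrow> real" where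
  "X1 f x = pd1 f x"

definition X2 :: "(real \<times> real \<Rightarrow> real) \<Rightarrow> real \<times> real \<Rightarrow> real" where
  "X2 f x = fst x * pd2 f x"

definition grushin_op ::
  "(real \<times> real \<Rightarrow> real) \<Rightarrow> (real \<times> real \<Rightarrow> real) \<Rightarrow> (real \<times> real \<Rightarrow> real) \<Rightarrow>
   (real \<times> real \<Rightarrow> real) \<Rightarrow> real \<times> real \<Rightarrow> real" where
  "grushin_op a11 a12 a22 u x =
     a11 x * X1 (X1 u) x + 2 * a12 x * X2 (X1 u) x + a22 x * X2 (X2 u) x"

text \<open>Measurability of the coefficients is Lebesgue measurability, the more general choice.\<close>

definition ellipticity_constants ::
  "real \<Rightarrow> real \<Rightarrow> (real \<times> real \<Rightarrow> real) \<Rightarrow> (real \<times> real \<Rightarrow> real) \<Rightarrow>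
   (real \<times> real \<Rightarrow> real) \<Rightarrow> bool" where
  "ellipticity_constants lam Lam a11 a12 a22 \<longleftrightarrow>
     a11 \<in> borel_measurable lebesgue \<and> a12 \<in> borel_measurable lebesgue \<and>
     a22 \<in> borel_measurable lebesgue \<and>
     (\<forall>x \<xi>1 \<xi>2. lam * (\<xi>1\<^sup>2 + \<xi>2\<^sup>2) \<le> a11 x * \<xi>1\<^sup>2 + 2 * a12 x * \<xi>1 * \<xi>2 + a22 x * \<xi>2\<^sup>2 \<and>
                a11 x * \<xi>1\<^sup>2 + 2 * a12 x * \<xi>1 * \<xi>2 + a22 x * \<xi>2\<^sup>2 \<le> Lam * (\<xi>1\<^sup>2 + \<xi>2\<^sup>2))"

definition d_tilde :: "real \<times> real \<Rightarrow> real \<times> real \<Rightarrow> real" where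
  "d_tilde x y =
     \<bar>fst x - fst y\<bar> + sqrt ((fst x)\<^sup>2 + (fst y)\<^sup>2 + 4 * \<bar>snd x - snd y\<bar>)
       - sqrt ((fst x)\<^sup>2 + (fst y)\<^sup>2)"

definition gball :: "real \<times> real \<Rightarrow> real \<Rightarrow> (real \<times> real) set" where
  "gball y r = {x. d_tilde x y < r}"

end

theory Submission
  imports Defs
begin

text \<open>Work with the boxes \<open>{z. |z1 - x1| < r, |z2 - x2| < r (|x1| + r)}\<close>, which are comparable with the
  balls of the quasi-distance. For a pole \<open>(p, q)\<close> with \<open>|p|\<close> comparable to \<open>|x1| + r\<close>, the Gaussian
  \<open>exp (- \<alpha> ((z1 - p)\<^sup>2 / r\<^sup>2 + (z2 - q)\<^sup>2 / (r s)\<^sup>2))\<close>, \<open>s = |x1| + r\<close>, is for large \<open>\<alpha>\<close> a strict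
  subsolution of every admissible operator away from a small box around the pole, even across the
  degenerate line \<open>z1 = 0\<close>. Subtracting a multiple of it from \<open>u\<close> and minimising the difference minus
  affine functions, all contact points lie in that small box, where the operator is uniformly
  elliptic; so the Jacobian of the gradient map is bounded there and no degenerate weight enters the
  Aleksandrov estimate. Hence \<open>u\<close> is bounded on a fixed proportion of the small box as soon as it is
  small somewhere in the large one. A Vitali covering argument, whose stopping scale at each point is
  one at which this proportion is seen while at half the scale it no longer is, turns this into
  geometric decay of the super-level sets on a box. The number of steps absorbed into one power of
  \<open>M\<close> is then taken so large that the constant lost in passing from the box to the ball disappears.\<close>

section \<open>Measure in the plane\<close>

definition rect :: "real \<times> real \<Rightarrow> real \<Rightarrow> real \<Rightarrow> (real \<times> real) set" where
  "rect x a b = {fst x - a<..<fst x + a} \<times> {snd x - b<..<snd x + b}"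

lemma mem_rect: "z \<in> rect x a b \<longleftrightarrow> \<bar>fst z - fst x\<bar> < a \<and> \<bar>snd z - snd x\<bar> < b"
  by (cases z) (auto simp: rect_def abs_less_iff)

lemma rect_eq_box: "rect x a b = box (fst x - a, snd x - b) (fst x + a, snd x + b)"
  by (auto simp: rect_def box_def Basis_prod_def)

lemma open_rect: "open (rect x a b)"
  by (simp add: rect_eq_box open_box)

lemma lmeasurable_rect [simp]: "rect x a b \<in> lmeasurable"
  by (simp add: rect_eq_box)

lemma measure_rect:
  assumes "0 \<le> a" "0 \<le> b"
  shows "measure lebesgue (rect x a b) = 4 * a * b"
proof -
  have "measure lebesgue (rect x a b) = measure lborel (rect x a b)"
    by (simp add: rect_eq_box)
  also have "\<dots> = 4 * a * b"
    unfolding rect_eq_box using assms by (subst measure_lborel_box_eq) (auto simp: Basis_prod_def)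
  finally show ?thesis .
qed

section \<open>Identification of the plane with \<open>real ^ 2\<close>\<close>

definition vec_of_pair :: "real \<times> real \<Rightarrow> real^2" where
  "vec_of_pair p = vector [fst p, snd p]"

definition pair_of_vec :: "real^2 \<Rightarrow> real \<times> real" where
  "pair_of_vec v = (v $ 1, v $ 2)"

lemma pair_of_vec_vec_of_pair [simp]: "pair_of_vec (vec_of_pair p) = p"
  by (simp add: pair_of_vec_def vec_of_pair_def)

lemma vec_of_pair_pair_of_vec [simp]: "vec_of_pair (pair_of_vec v) = v"
  by (simp add: pair_of_vec_def vec_of_pair_def vec_eq_iff forall_2)

lemma vec_of_pair_nth [simp]: "vec_of_pair p $ 1 = fst p" "vec_of_pair p $ 2 = snd p"
  by (simp_all add: vec_of_pair_def)

lemma vec_of_pair_eq: "vec_of_pair p = fst p *\<^sub>R axis 1 1 + snd p *\<^sub>R axis 2 1"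
  by (simp add: vec_eq_iff forall_2 axis_def)

lemma bounded_linear_vec_of_pair: "bounded_linear vec_of_pair"
  unfolding vec_of_pair_eq [abs_def]
  by (simp add: bounded_linear_add bounded_linear_scaleR_const bounded_linear_fst bounded_linear_snd)

lemma bounded_linear_pair_of_vec: "bounded_linear pair_of_vec"
  unfolding pair_of_vec_def [abs_def]
  by (simp add: bounded_linear_Pair bounded_linear_vec_nth)

lemma vimage_pair_of_vec: "pair_of_vec -` S = vec_of_pair ` S"
proof
  show "pair_of_vec -` S \<subseteq> vec_of_pair ` S"
    by (metis imageI subsetI vec_of_pair_pair_of_vec vimageD)
qed auto

text \<open>Lebesgue measure is determined by its values on boxes, and the coordinate map carries
  boxes to boxes with the same side lengths.\<close>

lemma lborel_distr_pair_of_vec: "distr lborel borel pair_of_vec = lborel"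
proof (rule lborel_eqI [symmetric])
  fix l u :: "real \<times> real"
  assume le: "\<And>b. b \<in> Basis \<Longrightarrow> l \<bullet> b \<le> u \<bullet> b"
  have m: "pair_of_vec \<in> borel_measurable borel"
    by (intro borel_measurable_continuous_onI linear_continuous_on bounded_linear_pair_of_vec)
  have eq: "pair_of_vec -` box l u = box (vec_of_pair l) (vec_of_pair u)"
    by (auto simp: pair_of_vec_def mem_box_cart forall_2 mem_box Basis_prod_def inner_prod_def)
  have le2: "fst l \<le> fst u" "snd l \<le> snd u"
    using le[of "(1,0)"] le[of "(0,1)"] by (auto simp: Basis_prod_def inner_prod_def)
  have "emeasure lborel (box (vec_of_pair l) (vec_of_pair u))
        = (\<Prod>b\<in>Basis. (vec_of_pair u - vec_of_pair l) \<bullet> b)"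
    using le2 by (intro emeasure_lborel_box) (auto simp: Basis_vec_def inner_axis forall_2 UNIV_2)
  also have "\<dots> = (fst u - fst l) * (snd u - snd l)"
    by (simp add: Basis_vec_def inner_axis UNIV_2 axis_eq_axis mult.commute)
  also have "\<dots> = (\<Prod>b\<in>Basis. (u - l) \<bullet> b)"
    by (simp add: Basis_prod_def inner_prod_def mult.commute)
  finally show "emeasure (distr lborel borel pair_of_vec) (box l u) = (\<Prod>b\<in>Basis. (u - l) \<bullet> b)"
    using m by (simp add: emeasure_distr eq)
qed simp

lemma emeasure_vec_of_pair_image:
  assumes "S \<in> sets borel"
  shows "emeasure lborel (vec_of_pair ` S) = emeasure lborel S"
    and "vec_of_pair ` S \<in> sets borel"
proof -
  have m: "pair_of_vec \<in> borel_measurable borel"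
    by (intro borel_measurable_continuous_onI linear_continuous_on bounded_linear_pair_of_vec)
  show "emeasure lborel (vec_of_pair ` S) = emeasure lborel S"
    using arg_cong[OF lborel_distr_pair_of_vec, of "\<lambda>M. emeasure M S"] assms m
    by (simp add: emeasure_distr vimage_pair_of_vec)
  show "vec_of_pair ` S \<in> sets borel"
    using measurable_sets[OF m assms] by (simp add: vimage_pair_of_vec)
qed

lemma measure_lebesgue_vec_of_pair_image:
  assumes "S \<in> sets borel"
  shows "measure lebesgue (vec_of_pair ` S) = measure lebesgue S"
  using emeasure_vec_of_pair_image[OF assms] assms
  by (simp add: measure_def)

text \<open>The bound on the size of an image under a differentiable map is only available on
  \<open>real ^ 'n\<close>, hence the transfer.\<close>

lemma measure_image_jacobian_le:
  fixes f1 f2 f11 f12 f21 f22 :: "real \<times> real \<Rightarrow> real"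
  assumes S: "compact S"
    and f1: "\<And>z. z \<in> S \<Longrightarrow> (f1 has_derivative (\<lambda>h. fst h * f11 z + snd h * f12 z)) (at z)"
    and f2: "\<And>z. z \<in> S \<Longrightarrow> (f2 has_derivative (\<lambda>h. fst h * f21 z + snd h * f22 z)) (at z)"
    and cont: "continuous_on S (\<lambda>z. f11 z * f22 z - f12 z * f21 z)"
    and B: "\<And>z. z \<in> S \<Longrightarrow> \<bar>f11 z * f22 z - f12 z * f21 z\<bar> \<le> B"
    and V: "V \<in> sets borel" "V \<subseteq> (\<lambda>z. (f1 z, f2 z)) ` S"
  shows "measure lebesgue V \<le> B * measure lebesgue S"
proof -
  let ?S = "vec_of_pair ` S"
  define F where "F = (\<lambda>v. vec_of_pair (f1 (pair_of_vec v), f2 (pair_of_vec v)))"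
  define F' where "F' = (\<lambda>v h :: real^2. vec_of_pair
     (h $ 1 * f11 (pair_of_vec v) + h $ 2 * f12 (pair_of_vec v),
      h $ 1 * f21 (pair_of_vec v) + h $ 2 * f22 (pair_of_vec v)))"
  have cS: "compact ?S"
    by (intro compact_continuous_image S linear_continuous_on bounded_linear_vec_of_pair)
  then have mS: "?S \<in> lmeasurable"
    by (rule lmeasurable_compact)
  have deriv: "(F has_derivative F' v) (at v within ?S)" if "v \<in> ?S" for v
  proof -
    have vS: "pair_of_vec v \<in> S"
      using that by auto
    have p: "(pair_of_vec has_derivative pair_of_vec) (at v)"
      by (rule bounded_linear_imp_has_derivative[OF bounded_linear_pair_of_vec])
    have "((\<lambda>w. (f1 (pair_of_vec w), f2 (pair_of_vec w))) has_derivative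
       (\<lambda>h. (fst (pair_of_vec h) * f11 (pair_of_vec v) + snd (pair_of_vec h) * f12 (pair_of_vec v),
             fst (pair_of_vec h) * f21 (pair_of_vec v) + snd (pair_of_vec h) * f22 (pair_of_vec v))))
       (at v)"
      by (intro has_derivative_Pair has_derivative_compose[OF p f1[OF vS]]
          has_derivative_compose[OF p f2[OF vS]])
    from bounded_linear.has_derivative[OF bounded_linear_vec_of_pair this]
    show ?thesis
      unfolding F_def F'_def by (simp add: pair_of_vec_def has_derivative_at_withinI)
  qed
  have det: "det (matrix (F' v)) = f11 (pair_of_vec v) * f22 (pair_of_vec v)
      - f12 (pair_of_vec v) * f21 (pair_of_vec v)" for v
    by (simp add: det_2 matrix_def F'_def axis_def)
  have bd: "\<bar>det (matrix (F' v))\<bar> \<le> B" if "v \<in> ?S" for v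
    using that B by (auto simp: det)
  have "continuous_on ?S (\<lambda>v. det (matrix (F' v)))"
    unfolding det
    by (rule continuous_on_compose2[OF cont])
      (auto intro: linear_continuous_on bounded_linear_pair_of_vec)
  then have ca: "continuous_on ?S (\<lambda>v. \<bar>det (matrix (F' v))\<bar>)"
    by (intro continuous_intros)
  \<comment> \<open>The determinant is continuous and bounded by \<open>B\<close> on a set of finite
    measure, hence integrable as the image bound requires.\<close>
  have int: "(\<lambda>v. \<bar>det (matrix (F' v))\<bar>) integrable_on ?S"
  proof (rule measurable_bounded_by_integrable_imp_integrable)
    show "(\<lambda>v. B) integrable_on ?S"
      by (rule integrable_on_const[OF mS])
  qed (use ca bd mS in \<open>auto intro: continuous_imp_measurable_on_sets_lebesgue\<close>)
  have "measure lebesgue (F ` ?S) \<le> B * measure lebesgue ?S" "F ` ?S \<in> lmeasurable"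
    using measure_bounded_differentiable_image[OF mS deriv int bd]
      measurable_bounded_differentiable_image[OF mS deriv int bd] by auto
  moreover have "vec_of_pair ` V \<subseteq> F ` ?S"
    using V(2) by (force simp: F_def)
  moreover have "vec_of_pair ` V \<in> sets lebesgue"
    using emeasure_vec_of_pair_image(2)[OF V(1)] by simp
  ultimately have "measure lebesgue (vec_of_pair ` V) \<le> B * measure lebesgue ?S"
    by (meson measure_mono_fmeasurable order_trans)
  then show ?thesis
    using measure_lebesgue_vec_of_pair_image V(1) borel_compact[OF S] by simp
qed

section \<open>Calculus of two variables\<close>

lemma C1_on_pd:
  assumes "C1_on U f" "(s, t) \<in> U"
  shows "((\<lambda>s. f (s, t)) has_real_derivative pd1 f (s, t)) (at s)"
    and "((\<lambda>t. f (s, t)) has_real_derivative pd2 f (s, t)) (at t)"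
proof -
  have "(\<lambda>t'. f (t', snd (s, t))) field_differentiable at (fst (s, t)) \<and>
        (\<lambda>t'. f (fst (s, t), t')) field_differentiable at (snd (s, t))"
    using assms(1) unfolding C1_on_def by (meson assms(2))
  then show "((\<lambda>s. f (s, t)) has_real_derivative pd1 f (s, t)) (at s)"
    and "((\<lambda>t. f (s, t)) has_real_derivative pd2 f (s, t)) (at t)"
    by (simp_all add: pd1_def pd2_def DERIV_deriv_iff_field_differentiable)
qed

lemma C1_on_continuous:
  assumes "C1_on U f"
  shows "continuous_on U (pd1 f)" "continuous_on U (pd2 f)"
  using assms by (auto simp: C1_on_def)

text \<open>\<open>C1_on\<close> supplies partial derivatives only. The total derivative comes from
  the continuity of \<open>pd2 f\<close> on a product neighbourhood of \<open>z\<close>, whose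
  second factor is shrunk to a ball to make it convex.\<close>

lemma C1_on_has_derivative:
  assumes C1: "C1_on U f" and U: "open U" and z: "z \<in> U"
  shows "(f has_derivative (\<lambda>h. fst h * pd1 f z + snd h * pd2 f z)) (at z)"
proof -
  obtain X Y where XY: "open X" "open Y" "z \<in> X \<times> Y" "X \<times> Y \<subseteq> U"
    using open_prod_elim[OF U z] by metis
  obtain d where d: "d > 0" "ball (snd z) d \<subseteq> Y"
    using openE[OF XY(2), of "snd z"] XY(3) by (metis mem_Sigma_iff prod.collapse)
  define Y' where "Y' = ball (snd z) d"
  have XY': "X \<times> Y' \<subseteq> U" "fst z \<in> X" "snd z \<in> Y'" "open (X \<times> Y')"
    using XY d by (auto simp: Y'_def open_Times)
  have "((\<lambda>(x, y). f (x, y)) has_derivative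
      (\<lambda>(tx, ty). tx * pd1 f (fst z, snd z)
         + blinfun_apply (pd2 f (fst z, snd z) *\<^sub>R id_blinfun) ty)) (at (fst z, snd z) within X \<times> Y')"
  proof (rule has_derivative_partialsI)
    show "((\<lambda>x. f (x, snd z)) has_derivative (\<lambda>tx. tx * pd1 f (fst z, snd z))) (at (fst z) within X)"
      using C1_on_pd(1)[OF C1, of "fst z" "snd z"] z
      by (simp add: has_field_derivative_def mult_commute_abs has_derivative_at_withinI)
  next
    fix x y assume "x \<in> X" "y \<in> Y'"
    then have "(x, y) \<in> U"
      using XY' by auto
    moreover have "blinfun_apply (pd2 f (x, y) *\<^sub>R id_blinfun) = (*) (pd2 f (x, y))"
      by (auto simp: blinfun.scaleR_left)
    ultimately show "((\<lambda>y. f (x, y)) has_derivative blinfun_apply (pd2 f (x, y) *\<^sub>R id_blinfun)) (at y within Y')"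
      using C1_on_pd(2)[OF C1, of x y]
      by (simp add: has_field_derivative_def has_derivative_at_withinI)
  next
    have "continuous_on (X \<times> Y') (pd2 f)"
      using C1_on_continuous[OF C1] XY'(1) continuous_on_subset by blast
    then have "continuous_on (X \<times> Y') (\<lambda>p. pd2 f p *\<^sub>R (id_blinfun :: real \<Rightarrow>\<^sub>L real))"
      by (intro continuous_intros)
    then show "continuous (at (fst z, snd z) within X \<times> Y')
        (\<lambda>(x, y). pd2 f (x, y) *\<^sub>R (id_blinfun :: real \<Rightarrow>\<^sub>L real))"
      using XY'(2,3) continuous_on_eq_continuous_within[THEN iffD1, rule_format, of "X \<times> Y'" _ z]
      by (simp add: split_def mem_Times_iff)
  next
    show "snd z \<in> Y'" "convex Y'"
      using XY'(3) by (simp_all add: Y'_def)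
  qed
  moreover have "(\<lambda>(tx, ty). tx * pd1 f (fst z, snd z)
      + blinfun_apply (pd2 f (fst z, snd z) *\<^sub>R id_blinfun) ty) =
      (\<lambda>h. fst h * pd1 f z + snd h * pd2 f z)"
    by (auto simp: blinfun.scaleR_left)
  moreover have "at (fst z, snd z) within X \<times> Y' = at z"
    using at_within_open[of z "X \<times> Y'"] XY' by (simp add: mem_Times_iff)
  ultimately show ?thesis
    by simp
qed

lemma C1_on_imp_continuous_on:
  assumes "C1_on U f" "open U"
  shows "continuous_on U f"
proof (intro continuous_at_imp_continuous_on ballI)
  fix z assume "z \<in> U"
  then show "isCont f z"
    using has_derivative_continuous[OF C1_on_has_derivative[OF assms]] by blast
qed

section \<open>Symmetry of second derivatives\<close>

text \<open>Mean value theorem twice: in the first variable for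
  \<open>f (s, b+h) - f (s, b)\<close>, then in the second variable for \<open>pd1 f\<close>. The
  opposite order, in \<open>second_difference'\<close>, expresses the same quantity by the other
  mixed derivative.\<close>

lemma second_difference:
  assumes C: "C1_on U f" "C1_on U (pd1 f)" and sub: "{a..a+h} \<times> {b..b+h} \<subseteq> U" and h: "h > 0"
  obtains p where "p \<in> {a..a+h} \<times> {b..b+h}"
    "f (a+h, b+h) - f (a+h, b) - f (a, b+h) + f (a, b) = h\<^sup>2 * pd2 (pd1 f) p"
proof -
  have "((\<lambda>s. f (s, b+h) - f (s, b)) has_real_derivative pd1 f (s, b+h) - pd1 f (s, b)) (at s)"
    if "a \<le> s" "s \<le> a + h" for s
    using that sub h by (intro derivative_intros C1_on_pd(1)[OF C(1)]) auto
  then obtain s where s: "a < s" "s < a + h"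
    "(f (a+h, b+h) - f (a+h, b)) - (f (a, b+h) - f (a, b)) = h * (pd1 f (s, b+h) - pd1 f (s, b))"
    using MVT2[of a "a+h" "\<lambda>s. f (s, b+h) - f (s, b)" "\<lambda>s. pd1 f (s, b+h) - pd1 f (s, b)"] h
    by auto
  have "((\<lambda>t. pd1 f (s, t)) has_real_derivative pd2 (pd1 f) (s, t)) (at t)"
    if "b \<le> t" "t \<le> b + h" for t
    using that sub s(1,2) by (intro C1_on_pd(2)[OF C(2)]) auto
  then obtain t where t: "b < t" "t < b + h"
    "pd1 f (s, b+h) - pd1 f (s, b) = h * pd2 (pd1 f) (s, t)"
    using MVT2[of b "b+h" "\<lambda>t. pd1 f (s, t)" "\<lambda>t. pd2 (pd1 f) (s, t)"] h
    by auto
  have "f (a+h, b+h) - f (a+h, b) - f (a, b+h) + f (a, b) = h * (h * pd2 (pd1 f) (s, t))"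
    using s(3) unfolding t(3) by linarith
  then show thesis
    using s(1,2) t(1,2) by (intro that[of "(s, t)"]) (auto simp: power2_eq_square)
qed

lemma second_difference':
  assumes C: "C1_on U f" "C1_on U (pd2 f)" and sub: "{a..a+h} \<times> {b..b+h} \<subseteq> U" and h: "h > 0"
  obtains p where "p \<in> {a..a+h} \<times> {b..b+h}"
    "f (a+h, b+h) - f (a+h, b) - f (a, b+h) + f (a, b) = h\<^sup>2 * pd1 (pd2 f) p"
proof -
  have "((\<lambda>t. f (a+h, t) - f (a, t)) has_real_derivative pd2 f (a+h, t) - pd2 f (a, t)) (at t)"
    if "b \<le> t" "t \<le> b + h" for t
    using that sub h by (intro derivative_intros C1_on_pd(2)[OF C(1)]) auto
  then obtain t where t: "b < t" "t < b + h"
    "(f (a+h, b+h) - f (a, b+h)) - (f (a+h, b) - f (a, b)) = h * (pd2 f (a+h, t) - pd2 f (a, t))"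
    using MVT2[of b "b+h" "\<lambda>t. f (a+h, t) - f (a, t)" "\<lambda>t. pd2 f (a+h, t) - pd2 f (a, t)"] h
    by auto
  have "((\<lambda>s. pd2 f (s, t)) has_real_derivative pd1 (pd2 f) (s, t)) (at s)"
    if "a \<le> s" "s \<le> a + h" for s
    using that sub t(1,2) by (intro C1_on_pd(1)[OF C(2)]) auto
  then obtain s where s: "a < s" "s < a + h"
    "pd2 f (a+h, t) - pd2 f (a, t) = h * pd1 (pd2 f) (s, t)"
    using MVT2[of a "a+h" "\<lambda>s. pd2 f (s, t)" "\<lambda>s. pd1 (pd2 f) (s, t)"] h
    by auto
  have "f (a+h, b+h) - f (a+h, b) - f (a, b+h) + f (a, b) = h * (h * pd1 (pd2 f) (s, t))"
    using t(3) unfolding s(3) by linarith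
  then show thesis
    using s(1,2) t(1,2) by (intro that[of "(s, t)"]) (auto simp: power2_eq_square)
qed

text \<open>Over a small square at \<open>z\<close> the second difference is
  \<open>h\<^sup>2\<close> times either mixed derivative, each taken at some point of the square;
  continuity brings both values close to those at \<open>z\<close>.\<close>

lemma pd_commute:
  assumes C2: "C2_on U f" and U: "open U" and z: "z \<in> U"
  shows "pd1 (pd2 f) z = pd2 (pd1 f) z"
proof (rule ccontr)
  assume neq: "pd1 (pd2 f) z \<noteq> pd2 (pd1 f) z"
  define e where "e = \<bar>pd1 (pd2 f) z - pd2 (pd1 f) z\<bar> / 2"
  have e: "e > 0"
    using neq by (simp add: e_def)
  have C: "C1_on U f" "C1_on U (pd1 f)" "C1_on U (pd2 f)"
    using C2 by (auto simp: C2_on_def)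
  have "continuous (at z) (pd1 (pd2 f))" "continuous (at z) (pd2 (pd1 f))"
    using C1_on_continuous(1)[OF C(3)] C1_on_continuous(2)[OF C(2)] z
    by (simp_all add: continuous_on_eq_continuous_at[OF U])
  then obtain d1 d2 where d: "d1 > 0" "d2 > 0"
    "\<And>p. dist p z < d1 \<Longrightarrow> dist (pd1 (pd2 f) p) (pd1 (pd2 f) z) < e"
    "\<And>p. dist p z < d2 \<Longrightarrow> dist (pd2 (pd1 f) p) (pd2 (pd1 f) z) < e"
    using e unfolding continuous_at_eps_delta by metis
  obtain d3 where d3: "d3 > 0" "ball z d3 \<subseteq> U"
    using openE[OF U z] by blast
  \<comment> \<open>The square of side \<open>h\<close> lies within distance \<open>2 * h\<close> of
    \<open>z\<close>; the factor 4 keeps this strictly below all three radii.\<close>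
  define h where "h = min d1 (min d2 d3) / 4"
  have h: "h > 0" "2 * h < d1" "2 * h < d2" "2 * h < d3"
    using d d3 by (auto simp: h_def)
  have near: "dist p z \<le> 2 * h" if "p \<in> {fst z..fst z+h} \<times> {snd z..snd z+h}" for p
  proof -
    have "dist p z \<le> \<bar>fst p - fst z\<bar> + \<bar>snd p - snd z\<bar>"
      by (simp add: dist_prod_def dist_real_def sqrt_sum_squares_le_sum_abs)
    with that show ?thesis by auto
  qed
  have "{fst z..fst z+h} \<times> {snd z..snd z+h} \<subseteq> ball z d3"
    using near h by (force simp: dist_commute)
  then have sub: "{fst z..fst z+h} \<times> {snd z..snd z+h} \<subseteq> U"
    using d3 by blast
  obtain p where p: "p \<in> {fst z..fst z+h} \<times> {snd z..snd z+h}"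
    "f (fst z+h, snd z+h) - f (fst z+h, snd z) - f (fst z, snd z+h) + f (fst z, snd z) = h\<^sup>2 * pd2 (pd1 f) p"
    using second_difference[OF C(1,2) sub h(1)] by metis
  obtain q where q: "q \<in> {fst z..fst z+h} \<times> {snd z..snd z+h}"
    "f (fst z+h, snd z+h) - f (fst z+h, snd z) - f (fst z, snd z+h) + f (fst z, snd z) = h\<^sup>2 * pd1 (pd2 f) q"
    using second_difference'[OF C(1,3) sub h(1)] by metis
  have "pd2 (pd1 f) p = pd1 (pd2 f) q"
    using p(2) q(2) h by simp
  moreover have "dist (pd1 (pd2 f) q) (pd1 (pd2 f) z) < e" "dist (pd2 (pd1 f) p) (pd2 (pd1 f) z) < e"
    using near[OF p(1)] near[OF q(1)] h d(3)[of q] d(4)[of p] by auto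
  ultimately show False
    unfolding e_def dist_real_def by argo
qed

section \<open>Minimum points and the gradient map\<close>

text \<open>A negative \<open>c\<close> would make \<open>g'\<close> negative just to the right of
  0, and the mean value theorem would give a value below \<open>g 0\<close>.\<close>

lemma second_derivative_nonneg_at_min:
  fixes g g' :: "real \<Rightarrow> real"
  assumes d: "d > 0"
    and g: "\<And>t. \<bar>t\<bar> < d \<Longrightarrow> (g has_real_derivative g' t) (at t)"
    and g': "(g' has_real_derivative c) (at 0)"
    and min: "\<And>t. \<bar>t\<bar> < d \<Longrightarrow> g 0 \<le> g t"
  shows "g' 0 = 0" "c \<ge> 0"
proof -
  show g0: "g' 0 = 0"
    using g[of 0] d min by (intro DERIV_local_min[of g "g' 0" 0 d]) auto
  show "c \<ge> 0"
  proof (rule ccontr)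
    assume "\<not> c \<ge> 0"
    then obtain e where e: "e > 0" "\<And>h. 0 < h \<Longrightarrow> h < e \<Longrightarrow> g' h < 0"
      using DERIV_neg_dec_right[OF g'] g0 by auto
    define b where "b = min d e / 2"
    have b: "0 < b" "b < d" "b < e"
      using d e by (auto simp: b_def)
    obtain t where t: "0 < t" "t < b" "g b - g 0 = (b - 0) * g' t"
      using MVT2[of 0 b g g'] g b by auto
    then have "g b - g 0 < 0"
      using e b by (simp add: mult_pos_neg)
    with min[of b] b show False by auto
  qed
qed

text \<open>Reduction to one variable along the line through \<open>z\<close> in direction
  \<open>(\<xi>, \<zeta>)\<close>. Both derivative hypotheses share the entry \<open>F12\<close>, so
  symmetry of the Hessian is built in.\<close>

lemma local_min_gradient_hessian:
  fixes F :: "real \<times> real \<Rightarrow> real"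
  assumes D: "open D" "z \<in> D" and min: "\<And>p. p \<in> D \<Longrightarrow> F z \<le> F p"
    and F: "\<And>p. p \<in> D \<Longrightarrow> (F has_derivative (\<lambda>h. fst h * F1 p + snd h * F2 p)) (at p)"
    and F1: "(F1 has_derivative (\<lambda>h. fst h * F11 + snd h * F12)) (at z)"
    and F2: "(F2 has_derivative (\<lambda>h. fst h * F12 + snd h * F22)) (at z)"
  shows "F1 z = 0" "F2 z = 0" "F11 * \<xi>\<^sup>2 + 2 * F12 * \<xi> * \<zeta> + F22 * \<zeta>\<^sup>2 \<ge> 0"
proof -
  have *: "\<xi> * F1 z + \<zeta> * F2 z = 0 \<and> F11 * \<xi>\<^sup>2 + 2 * F12 * \<xi> * \<zeta> + F22 * \<zeta>\<^sup>2 \<ge> 0" for \<xi> \<zeta>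
  proof -
    define L where "L = (\<lambda>t. (fst z + t * \<xi>, snd z + t * \<zeta>))"
    have L0: "L 0 = z"
      by (simp add: L_def)
    have Ld: "(L has_derivative (\<lambda>h. (h * \<xi>, h * \<zeta>))) (at t)" for t
      unfolding L_def by (auto intro!: derivative_eq_intros)
    have "continuous_on UNIV L"
      unfolding L_def by (intro continuous_intros)
    then have "open (L -` D)"
      using D(1) open_vimage by blast
    then obtain d where d: "d > 0" "ball 0 d \<subseteq> L -` D"
      using openE[of "L -` D" 0] D L0 by auto
    have g: "((\<lambda>t. F (L t)) has_real_derivative \<xi> * F1 (L t) + \<zeta> * F2 (L t)) (at t)" if "\<bar>t\<bar> < d" for t
    proof -
      have "L t \<in> D"
        using that d by (auto simp: subset_iff dist_real_def)
      from has_derivative_compose[OF Ld F[OF this]]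
      have "((\<lambda>t. F (L t)) has_derivative (\<lambda>h. h * (\<xi> * F1 (L t) + \<zeta> * F2 (L t)))) (at t)"
        by (simp add: algebra_simps)
      then show ?thesis
        by (simp add: has_field_derivative_def mult_commute_abs)
    qed
    have "((\<lambda>t. F1 (L t)) has_real_derivative \<xi> * F11 + \<zeta> * F12) (at 0)"
    proof -
      have "((\<lambda>t. F1 (L t)) has_derivative (\<lambda>h. h * (\<xi> * F11 + \<zeta> * F12))) (at 0)"
        using has_derivative_compose[OF Ld F1[folded L0]] by (simp add: algebra_simps)
      then show ?thesis
        by (simp add: has_field_derivative_def mult_commute_abs)
    qed
    moreover have "((\<lambda>t. F2 (L t)) has_real_derivative \<xi> * F12 + \<zeta> * F22) (at 0)"
    proof -
      have "((\<lambda>t. F2 (L t)) has_derivative (\<lambda>h. h * (\<xi> * F12 + \<zeta> * F22))) (at 0)"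
        using has_derivative_compose[OF Ld F2[folded L0]] by (simp add: algebra_simps)
      then show ?thesis
        by (simp add: has_field_derivative_def mult_commute_abs)
    qed
    ultimately have g': "((\<lambda>t. \<xi> * F1 (L t) + \<zeta> * F2 (L t)) has_real_derivative
       \<xi> * (\<xi> * F11 + \<zeta> * F12) + \<zeta> * (\<xi> * F12 + \<zeta> * F22)) (at 0)"
      by (auto intro!: derivative_eq_intros)
    have min': "F (L 0) \<le> F (L t)" if "\<bar>t\<bar> < d" for t
      using that d min by (auto simp: subset_iff dist_real_def L0)
    show ?thesis
      using second_derivative_nonneg_at_min[OF d(1) g g' min']
      by (simp add: L0 algebra_simps power2_eq_square)
  qed
  show "F1 z = 0" "F2 z = 0"
    using *[of 1 0] *[of 0 1] by auto
  show "F11 * \<xi>\<^sup>2 + 2 * F12 * \<xi> * \<zeta> + F22 * \<zeta>\<^sup>2 \<ge> 0"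
    using * by blast
qed

text \<open>Aleksandrov's argument: subtracting an affine function whose slope is small compared with
  the depth of \<open>w\<close> keeps the minimum of \<open>w\<close> in the interior.\<close>

lemma small_slope_attained:
  fixes w :: "real \<times> real \<Rightarrow> real"
  assumes D: "compact D" "z0 \<in> D" and G: "open G" "G \<subseteq> D"
    and cont: "continuous_on D w" and low: "w z0 \<le> - l" and bd: "\<And>z. z \<in> D - G \<Longrightarrow> w z \<ge> 0"
    and w: "\<And>p. p \<in> G \<Longrightarrow> (w has_derivative (\<lambda>h. fst h * w1 p + snd h * w2 p)) (at p)"
    and w1: "\<And>p. p \<in> G \<Longrightarrow> (w1 has_derivative (\<lambda>h. fst h * w11 p + snd h * w12 p)) (at p)"
    and w2: "\<And>p. p \<in> G \<Longrightarrow> (w2 has_derivative (\<lambda>h. fst h * w12 p + snd h * w22 p)) (at p)"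
    and v: "\<And>z. z \<in> D \<Longrightarrow> v1 * (fst z - fst z0) + v2 * (snd z - snd z0) < l"
  obtains z where "z \<in> G" "w1 z = v1" "w2 z = v2" "w z < 0"
    "\<forall>\<xi> \<zeta>. w11 z * \<xi>\<^sup>2 + 2 * w12 z * \<xi> * \<zeta> + w22 z * \<zeta>\<^sup>2 \<ge> 0"
proof -
  define F where "F = (\<lambda>z. w z - (v1 * (fst z - fst z0) + v2 * (snd z - snd z0)))"
  have "continuous_on D F"
    unfolding F_def by (intro continuous_intros cont)
  then obtain z where z: "z \<in> D" "\<And>p. p \<in> D \<Longrightarrow> F z \<le> F p"
    using continuous_attains_inf[OF D(1), of F] D(2) by blast
  have "F z \<le> - l"
    using z(2)[OF D(2)] low by (simp add: F_def)
  \<comment> \<open>The affine term vanishes at \<open>z0\<close> and stays below \<open>l\<close>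
    on \<open>D\<close>, so a minimum value of at most \<open>- l\<close> forces
    \<open>w z < 0\<close>; this excludes \<open>D - G\<close>.\<close>
  then have wz: "w z < 0"
    using v[OF z(1)] by (simp add: F_def)
  then have zG: "z \<in> G"
    using bd[of z] z(1) wz by force
  have F: "(F has_derivative (\<lambda>h. fst h * (w1 p - v1) + snd h * (w2 p - v2))) (at p)" if "p \<in> G" for p
    unfolding F_def using w[OF that]
    by (auto intro!: derivative_eq_intros simp: algebra_simps)
  have F1: "((\<lambda>p. w1 p - v1) has_derivative (\<lambda>h. fst h * w11 z + snd h * w12 z)) (at z)"
    using w1[OF zG] by (auto intro!: derivative_eq_intros)
  have F2: "((\<lambda>p. w2 p - v2) has_derivative (\<lambda>h. fst h * w12 z + snd h * w22 z)) (at z)"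
    using w2[OF zG] by (auto intro!: derivative_eq_intros)
  have m: "F z \<le> F p" if "p \<in> G" for p
    using z(2) that G(2) by blast
  note lm = local_min_gradient_hessian[OF G(1) zG m F F1 F2]
  show thesis
    using lm by (intro that[OF zG _ _ wz]) auto
qed

section \<open>The operator and the Gaussian barrier\<close>

definition gbox :: "real \<times> real \<Rightarrow> real \<Rightarrow> (real \<times> real) set" where
  "gbox x r = rect x r (r * (\<bar>fst x\<bar> + r))"

section \<open>Positive semidefinite forms and ellipticity\<close>

lemma psd_coeffs:
  fixes A B C :: real
  assumes "\<And>\<xi> \<zeta>. A * \<xi>\<^sup>2 + 2 * B * \<xi> * \<zeta> + C * \<zeta>\<^sup>2 \<ge> 0"
  shows "A \<ge> 0" "C \<ge> 0" "B\<^sup>2 \<le> A * C"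
proof -
  show A: "A \<ge> 0" and "C \<ge> 0"
    using assms[of 1 0] assms[of 0 1] by simp_all
  show "B\<^sup>2 \<le> A * C"
  proof (cases "A = 0")
    case True
    \<comment> \<open>For \<open>A = 0\<close> the form at \<open>(- (C + 1) / 2, B)\<close> is
      exactly \<open>- (B\<^sup>2)\<close>.\<close>
    have "- (B\<^sup>2) \<ge> 0"
      using assms[of "- (C + 1) / 2" B] True by (simp add: power2_eq_square field_simps)
    then show ?thesis using True by simp
  next
    case False
    \<comment> \<open>The form at \<open>(- B, A)\<close> is \<open>A\<close> times the
      determinant.\<close>
    have "A * (A * C - B\<^sup>2) \<ge> 0"
      using assms[of "- B" A] by (simp add: power2_eq_square algebra_simps)
    then show ?thesis
      using A False by (simp add: zero_le_mult_iff)
  qed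
qed

text \<open>The expression is the trace of the product of two positive semidefinite symmetric
  matrices. The determinant conditions bound the square of the cross term by
  \<open>4 * (A * A') * (C * C')\<close>, and the arithmetic-geometric mean inequality
  finishes.\<close>

lemma trace_psd_mult_nonneg:
  fixes A B C A' B' C' :: real
  assumes "A \<ge> 0" "C \<ge> 0" "B\<^sup>2 \<le> A * C" "A' \<ge> 0" "C' \<ge> 0" "B'\<^sup>2 \<le> A' * C'"
  shows "A * A' + 2 * B * B' + C * C' \<ge> 0"
proof -
  have "(2 * B * B')\<^sup>2 = 4 * (B\<^sup>2 * B'\<^sup>2)"
    by (simp add: power2_eq_square)
  also have "\<dots> \<le> 4 * ((A * C) * (A' * C'))"
    using mult_mono[OF assms(3,6)] assms by simp
  also have "\<dots> \<le> (A * A' + C * C')\<^sup>2"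
    using zero_le_power2[of "A * A' - C * C'"] by (simp add: power2_eq_square algebra_simps)
  finally have "\<bar>2 * B * B'\<bar> \<le> \<bar>A * A' + C * C'\<bar>"
    by (simp only: abs_le_square_iff)
  moreover have "A * A' + C * C' \<ge> 0"
    using assms by simp
  ultimately show ?thesis by linarith
qed

text \<open>Trace inequality for the coefficient matrix minus \<open>lam\<close> times the identity,
  against the Hessian conjugated by the diagonal matrix with entries 1 and \<open>t\<close>. With
  \<open>t\<close> the first coordinate, this is the Hessian seen by the Grushin fields.\<close>

lemma elliptic_trace_lower:
  fixes a b c lam w11 w12 w22 t :: real
  assumes ell: "\<And>\<xi> \<zeta>. lam * (\<xi>\<^sup>2 + \<zeta>\<^sup>2) \<le> a * \<xi>\<^sup>2 + 2 * b * \<xi> * \<zeta> + c * \<zeta>\<^sup>2"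
    and psd: "\<And>\<xi> \<zeta>. w11 * \<xi>\<^sup>2 + 2 * w12 * \<xi> * \<zeta> + w22 * \<zeta>\<^sup>2 \<ge> 0"
  shows "lam * (w11 + t\<^sup>2 * w22) \<le> a * w11 + 2 * b * t * w12 + c * t\<^sup>2 * w22"
proof -
  have "(a - lam) * \<xi>\<^sup>2 + 2 * b * \<xi> * \<zeta> + (c - lam) * \<zeta>\<^sup>2 \<ge> 0" for \<xi> \<zeta>
    using ell[of \<xi> \<zeta>] by (simp add: algebra_simps)
  note A = psd_coeffs[OF this]
  note W = psd_coeffs[OF psd]
  have "(t * w12)\<^sup>2 \<le> w11 * (t\<^sup>2 * w22)"
    using mult_left_mono[OF W(3), of "t\<^sup>2"] by (simp add: power_mult_distrib mult.left_commute)
  from trace_psd_mult_nonneg[OF A W(1) _ this] W(2) show ?thesis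
    by (simp add: algebra_simps)
qed

text \<open>The weight in \<open>X2\<close> does not depend on the second coordinate, so it passes
  through \<open>pd2\<close>.\<close>

lemma grushin_op_eq:
  assumes C2: "C2_on U u" and z: "z \<in> U"
  shows "grushin_op a11 a12 a22 u z = a11 z * pd1 (pd1 u) z
    + 2 * a12 z * fst z * pd2 (pd1 u) z + a22 z * (fst z)\<^sup>2 * pd2 (pd2 u) z"
proof -
  have X1: "X1 f = pd1 f" for f
    by (simp add: X1_def fun_eq_iff)
  have "((\<lambda>t. pd2 u (fst z, t)) has_real_derivative pd2 (pd2 u) z) (at (snd z))"
    using C1_on_pd(2)[of U "pd2 u" "fst z" "snd z"] assms by (simp add: C2_on_def)
  then have "((\<lambda>t. fst z * pd2 u (fst z, t)) has_real_derivative fst z * pd2 (pd2 u) z) (at (snd z))"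
    by (rule DERIV_cmult)
  then have "pd2 (X2 u) z = fst z * pd2 (pd2 u) z"
    unfolding pd2_def[of "X2 u"] X2_def by (simp add: DERIV_imp_deriv)
  then show ?thesis
    by (simp add: grushin_op_def X1 X2_def[of "X2 u"] X2_def[of "pd1 u"] power2_eq_square)
qed

section \<open>The Gaussian barrier\<close>

text \<open>The weights \<open>k\<close> and \<open>m\<close> will be the inverse squares of a
  horizontal and a vertical length scale, so that level sets are ellipses adapted to a box;
  \<open>\<alpha>\<close> is the steepness.\<close>

definition gauss :: "real \<Rightarrow> real \<Rightarrow> real \<Rightarrow> real \<Rightarrow> real \<Rightarrow> real \<times> real \<Rightarrow> real" where
  "gauss \<alpha> p q k m z = exp (- \<alpha> * (k * (fst z - p)\<^sup>2 + m * (snd z - q)\<^sup>2))"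

lemma gauss_has_derivative:
  "(gauss \<alpha> p q k m has_derivative
     (\<lambda>h. fst h * (- 2 * \<alpha> * k * (fst z - p) * gauss \<alpha> p q k m z)
        + snd h * (- 2 * \<alpha> * m * (snd z - q) * gauss \<alpha> p q k m z))) (at z)"
  unfolding gauss_def [abs_def]
  by (auto intro!: derivative_eq_intros simp: algebra_simps)

lemma gauss_second_derivatives:
  "((\<lambda>z. - 2 * \<alpha> * k * (fst z - p) * gauss \<alpha> p q k m z) has_derivative
     (\<lambda>h. fst h * (((2 * \<alpha> * k * (fst z - p))\<^sup>2 - 2 * \<alpha> * k) * gauss \<alpha> p q k m z)
        + snd h * (4 * \<alpha>\<^sup>2 * k * m * (fst z - p) * (snd z - q) * gauss \<alpha> p q k m z))) (at z)"
  "((\<lambda>z. - 2 * \<alpha> * m * (snd z - q) * gauss \<alpha> p q k m z) has_derivative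
     (\<lambda>h. fst h * (4 * \<alpha>\<^sup>2 * k * m * (fst z - p) * (snd z - q) * gauss \<alpha> p q k m z)
        + snd h * (((2 * \<alpha> * m * (snd z - q))\<^sup>2 - 2 * \<alpha> * m) * gauss \<alpha> p q k m z))) (at z)"
  by (auto intro!: derivative_eq_intros gauss_has_derivative simp: algebra_simps power2_eq_square)

text \<open>The part quadratic in \<open>\<alpha>\<close> is the coefficient form at a gradient, at
  least \<open>lam\<close> times its squared length. The linear part is a trace, at most
  \<open>Lam\<close> times the trace of the weights. For large \<open>\<alpha>\<close> the first
  wins wherever that gradient is not too small.\<close>

lemma gauss_grushin_lower:
  fixes a b c lam Lam \<alpha> p q \<rho> s t y g :: real
  assumes lo: "\<And>\<xi> \<zeta>. lam * (\<xi>\<^sup>2 + \<zeta>\<^sup>2) \<le> a * \<xi>\<^sup>2 + 2 * b * \<xi> * \<zeta> + c * \<zeta>\<^sup>2"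
    and up: "\<And>\<xi> \<zeta>. a * \<xi>\<^sup>2 + 2 * b * \<xi> * \<zeta> + c * \<zeta>\<^sup>2 \<le> Lam * (\<xi>\<^sup>2 + \<zeta>\<^sup>2)"
    and pos: "\<alpha> > 0" "\<rho> > 0" "s > 0" "g \<ge> 0"
  defines "k \<equiv> 1 / \<rho>\<^sup>2" and "m \<equiv> 1 / (\<rho> * s)\<^sup>2"
  shows "a * (((2 * \<alpha> * k * (t - p))\<^sup>2 - 2 * \<alpha> * k) * g)
      + 2 * b * t * (4 * \<alpha>\<^sup>2 * k * m * (t - p) * (y - q) * g)
      + c * t\<^sup>2 * (((2 * \<alpha> * m * (y - q))\<^sup>2 - 2 * \<alpha> * m) * g)
    \<ge> \<alpha> / \<rho>\<^sup>2 * g * (4 * \<alpha> * lam * (((t - p) / \<rho>)\<^sup>2 + (t / s)\<^sup>2 * ((y - q) / (\<rho> * s))\<^sup>2)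
        - 2 * Lam * (1 + (t / s)\<^sup>2))"
proof -
  \<comment> \<open>\<open>(\<xi>, \<zeta>)\<close> is the Grushin gradient of the quadratic
    polynomial in the exponent of \<open>gauss\<close>.\<close>
  define \<xi> where "\<xi> = 2 * k * (t - p)"
  define \<zeta> where "\<zeta> = 2 * m * t * (y - q)"
  have ac: "a \<le> Lam" "c \<le> Lam"
    using up[of 1 0] up[of 0 1] by auto
  have mk: "m * t\<^sup>2 = (t / s)\<^sup>2 / \<rho>\<^sup>2"
    by (simp add: m_def power_divide power_mult_distrib)
  have sq: "\<xi>\<^sup>2 + \<zeta>\<^sup>2 = 4 / \<rho>\<^sup>2 * (((t - p) / \<rho>)\<^sup>2 + (t / s)\<^sup>2 * ((y - q) / (\<rho> * s))\<^sup>2)"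
    using pos by (simp add: \<xi>_def \<zeta>_def k_def m_def power_divide power_mult_distrib field_simps
        power2_eq_square)
  have "a * k + c * (m * t\<^sup>2) \<le> Lam * k + Lam * (m * t\<^sup>2)"
    using ac by (intro add_mono mult_right_mono) (auto simp: k_def m_def)
  also have "\<dots> = Lam / \<rho>\<^sup>2 * (1 + (t / s)\<^sup>2)"
    by (simp only: mk) (simp add: k_def algebra_simps)
  finally have tr: "a * k + c * (m * t\<^sup>2) \<le> Lam / \<rho>\<^sup>2 * (1 + (t / s)\<^sup>2)" .
  have "\<alpha> / \<rho>\<^sup>2 * g * (4 * \<alpha> * lam * (((t - p) / \<rho>)\<^sup>2 + (t / s)\<^sup>2 * ((y - q) / (\<rho> * s))\<^sup>2)
        - 2 * Lam * (1 + (t / s)\<^sup>2))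
      = \<alpha> * g * (\<alpha> * (lam * (\<xi>\<^sup>2 + \<zeta>\<^sup>2)) - 2 * (Lam / \<rho>\<^sup>2 * (1 + (t / s)\<^sup>2)))"
    unfolding sq by (simp add: algebra_simps)
  also have "\<dots> \<le> \<alpha> * g * (\<alpha> * (a * \<xi>\<^sup>2 + 2 * b * \<xi> * \<zeta> + c * \<zeta>\<^sup>2) - 2 * (a * k + c * (m * t\<^sup>2)))"
    using pos tr lo[of \<xi> \<zeta>] by (intro mult_left_mono diff_mono) auto
  also have "\<dots> = a * (((2 * \<alpha> * k * (t - p))\<^sup>2 - 2 * \<alpha> * k) * g)
      + 2 * b * t * (4 * \<alpha>\<^sup>2 * k * m * (t - p) * (y - q) * g)
      + c * t\<^sup>2 * (((2 * \<alpha> * m * (y - q))\<^sup>2 - 2 * \<alpha> * m) * g)"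
    by (simp add: \<xi>_def \<zeta>_def algebra_simps power2_eq_square)
  finally show ?thesis .
qed

lemma lmeasurable_sublevel:
  fixes u :: "real \<times> real \<Rightarrow> real"
  assumes "continuous_on A u" "A \<in> lmeasurable"
  shows "{z. u z \<le> c} \<inter> A \<in> lmeasurable"
proof -
  have "closedin (top_of_set A) (A \<inter> u -` {..c})"
    by (rule continuous_closedin_preimage[OF assms(1) closed_atMost])
  then have "A \<inter> u -` {..c} \<in> sets lebesgue"
    by (rule lebesgue_closedin[OF _ fmeasurableD[OF assms(2)]])
  moreover have "A \<inter> u -` {..c} = {z. u z \<le> c} \<inter> A"
    by auto
  ultimately show ?thesis
    using fmeasurableI2[OF assms(2) inf_le2] by metis
qed

text \<open>The pole is at distance at least \<open>s / 13\<close> from the degenerate line, so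
  within horizontal distance \<open>\<rho> / 64\<close> of it the weight
  \<open>\<bar>t\<bar>\<close> is still at least \<open>s / 26\<close>. Off the small box either the
  horizontal term is at least \<open>(1 / 64)\<^sup>2\<close>, or the vertical one is at least
  \<open>(1 / 26)\<^sup>2 * (1 / 64)\<^sup>2\<close>, which is \<open>1 / 2768896\<close>. The bound
  289 is \<open>17\<^sup>2\<close>.\<close>

lemma barrier_coefficient_bounds:
  fixes x p q \<rho> s t y :: real
  assumes \<rho>: "\<rho> > 0" and s: "s = \<bar>x\<bar> + \<rho>" and p: "\<bar>p - x\<bar> \<le> \<rho> / 2" "s \<le> 13 * \<bar>p\<bar>"
    and t: "\<bar>t - p\<bar> \<le> 16 * \<rho>"
  shows "(t / s)\<^sup>2 \<le> 289"
    and "\<bar>t - p\<bar> \<le> \<rho> / 64 \<Longrightarrow> s \<le> 26 * \<bar>t\<bar>"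
    and "\<bar>t - p\<bar> > \<rho> / 64 \<or> \<bar>y - q\<bar> > \<rho> * s / 64 \<Longrightarrow>
      ((t - p) / \<rho>)\<^sup>2 + (t / s)\<^sup>2 * ((y - q) / (\<rho> * s))\<^sup>2 \<ge> 1 / 2768896"
proof -
  have s0: "s > 0" "\<rho> \<le> s"
    using \<rho> s by auto
  have "\<bar>t\<bar> \<le> 17 * s"
    using \<rho> s p t by linarith
  then have "\<bar>t / s\<bar> \<le> 17"
    using s0 by (simp add: abs_divide divide_le_eq)
  then have "\<bar>t / s\<bar>\<^sup>2 \<le> 17\<^sup>2"
    by (intro power_mono) auto
  then show "(t / s)\<^sup>2 \<le> 289"
    unfolding power2_abs by simp
  show near: "s \<le> 26 * \<bar>t\<bar>" if "\<bar>t - p\<bar> \<le> \<rho> / 64"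
    using that s0 p(2) \<rho> by linarith
  show "((t - p) / \<rho>)\<^sup>2 + (t / s)\<^sup>2 * ((y - q) / (\<rho> * s))\<^sup>2 \<ge> 1 / 2768896"
    if far: "\<bar>t - p\<bar> > \<rho> / 64 \<or> \<bar>y - q\<bar> > \<rho> * s / 64"
  proof (cases "\<bar>t - p\<bar> \<le> \<rho> / 64")
    case False
    then have "1 / 64 \<le> \<bar>(t - p) / \<rho>\<bar>"
      using \<rho> by (simp add: abs_divide field_simps)
    then have "(1 / 64)\<^sup>2 \<le> ((t - p) / \<rho>)\<^sup>2"
      using power_mono[of "1 / 64" "\<bar>(t - p) / \<rho>\<bar>" 2] unfolding power2_abs by simp
    moreover have "(t / s)\<^sup>2 * ((y - q) / (\<rho> * s))\<^sup>2 \<ge> 0"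
      by simp
    moreover have "1 / 2768896 \<le> (1 / 64 :: real)\<^sup>2"
      by (simp add: power2_eq_square)
    ultimately show ?thesis
      by linarith
  next
    case True
    then have "1 / 64 \<le> \<bar>(y - q) / (\<rho> * s)\<bar>"
      using far \<rho> s0 by (simp add: abs_divide abs_mult field_simps)
    then have "(1 / 64)\<^sup>2 \<le> ((y - q) / (\<rho> * s))\<^sup>2"
      using power_mono[of "1 / 64" "\<bar>(y - q) / (\<rho> * s)\<bar>" 2] unfolding power2_abs by simp
    moreover have "1 / 26 \<le> \<bar>t / s\<bar>"
      using near[OF True] s0 by (simp add: abs_divide field_simps)
    then have "(1 / 26)\<^sup>2 \<le> (t / s)\<^sup>2"
      using power_mono[of "1 / 26" "\<bar>t / s\<bar>" 2] unfolding power2_abs by simp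
    ultimately have "(1 / 26)\<^sup>2 * (1 / 64)\<^sup>2 \<le> (t / s)\<^sup>2 * ((y - q) / (\<rho> * s))\<^sup>2"
      by (intro mult_mono) auto
    moreover have "((t - p) / \<rho>)\<^sup>2 \<ge> 0"
      by simp
    moreover have "1 / 2768896 = (1 / 26)\<^sup>2 * (1 / 64 :: real)\<^sup>2"
      by (simp add: power2_eq_square)
    ultimately show ?thesis
      by linarith
  qed
qed

lemma mem_cbox_pair:
  fixes z :: "real \<times> real"
  shows "z \<in> cbox (a - r, b - t) (a + r, b + t) \<longleftrightarrow> \<bar>fst z - a\<bar> \<le> r \<and> \<bar>snd z - b\<bar> \<le> t"
  by (cases z) auto

lemma has_derivative_diff_cmult:
  fixes F G :: "real \<times> real \<Rightarrow> real"
  assumes "(F has_derivative (\<lambda>h. fst h * a + snd h * b)) (at z)"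
    and "(G has_derivative (\<lambda>h. fst h * c + snd h * d)) (at z)"
  shows "((\<lambda>z. F z - K * G z) has_derivative
     (\<lambda>h. fst h * (a - K * c) + snd h * (b - K * d))) (at z)"
  by (rule has_derivative_eq_rhs[OF has_derivative_diff[OF assms(1)
        has_derivative_mult_right[OF assms(2)]]]) (auto simp: algebra_simps)

text \<open>The Aleksandrov estimate for \<open>u\<close> minus the Gaussian barrier: the set \<open>S\<close> of the proof contains
  all contact points, and the barrier is a strict subsolution outside the box \<open>K\<close>.\<close>

lemma level_set_lower_bound:
  fixes u a11 a12 a22 :: "real \<times> real \<Rightarrow> real"
  assumes lam: "0 < lam" "lam \<le> Lam"
    and \<alpha>: "\<alpha> > 0" "\<alpha> * lam \<ge> 10 ^ 9 * Lam"
    and T: "T = 2 / (exp (- 128 * \<alpha>) - exp (- 256 * \<alpha>))"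
    and ell: "ellipticity_constants lam Lam a11 a12 a22"
    and U: "open U" and C2: "C2_on U u" and u0: "\<And>z. z \<in> U \<Longrightarrow> u z \<ge> 0"
    and Lu: "\<And>z. z \<in> U \<Longrightarrow> grushin_op a11 a12 a22 u z \<le> 0"
    and \<rho>: "\<rho> > 0" and s: "s = \<bar>fst x\<bar> + \<rho>"
    and p: "\<bar>p - fst x\<bar> \<le> \<rho> / 2" "s \<le> 13 * \<bar>p\<bar>" and q: "\<bar>q - snd x\<bar> \<le> \<rho> * s / 2"
    and sub: "\<And>z. \<bar>fst z - p\<bar> \<le> 16 * \<rho> \<Longrightarrow> \<bar>snd z - q\<bar> \<le> 16 * (\<rho> * s) \<Longrightarrow> z \<in> U"
    and l: "l > 0" and z0: "z0 \<in> gbox x (3 * \<rho>)" "u z0 \<le> l"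
  shows "lam\<^sup>2 * \<rho>\<^sup>2 * s / (4096 * 676 * (580 * T * \<alpha> * Lam)\<^sup>2)
    \<le> measure lebesgue ({z. u z \<le> T * l} \<inter> rect (p, q) (\<rho> / 32) (\<rho> * s / 32))"
proof -
  have s0: "s > 0" "\<rho> \<le> s"
    using \<rho> s by auto
  have \<rho>s: "\<rho> * s > 0"
    using \<rho> s0 by simp
  have Lam: "Lam > 0"
    using lam by simp
  define k m where "k = 1 / \<rho>\<^sup>2" and "m = 1 / (\<rho> * s)\<^sup>2"
  have km: "k > 0" "m > 0"
    using \<rho> s0 by (auto simp: k_def m_def)
  define Q where "Q = (\<lambda>z :: real \<times> real. k * (fst z - p)\<^sup>2 + m * (snd z - q)\<^sup>2)"
  define g where "g = gauss \<alpha> p q k m"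
  have g: "g z = exp (- \<alpha> * Q z)" for z
    by (simp add: g_def gauss_def Q_def)
  have Q0: "Q z \<ge> 0" for z
    using km by (simp add: Q_def)
  have contQ: "continuous_on A Q" for A
    unfolding Q_def by (intro continuous_intros)
  have g01: "0 < g z" "g z \<le> 1" for z
    using Q0[of z] \<alpha> by (auto simp: g)
  have gap: "exp (- 128 * \<alpha>) - exp (- 256 * \<alpha>) > 0"
    using \<alpha> by simp
  then have T0: "T > 0"
    unfolding T by (intro divide_pos_pos) simp_all
  \<comment> \<open>Normalisation: the barrier defined below is at least \<open>2 * l\<close>
    wherever \<open>Q \<le> 128\<close>.\<close>
  have T2: "T * (exp (- 128 * \<alpha>) - exp (- 256 * \<alpha>)) = 2"
    using nonzero_eq_divide_eq[THEN iffD1, OF _ T] gap by linarith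

  \<comment> \<open>Since 256 is \<open>16\<^sup>2\<close>, this ellipse has semi-axes
    \<open>16 * \<rho>\<close> and \<open>16 * (\<rho> * s)\<close>, which is what
    \<open>sub\<close> places inside \<open>U\<close>.\<close>
  define D where "D = {z. Q z \<le> 256}"
  define G where "G = {z. Q z < 256}"
  have Dbd: "\<bar>fst z - p\<bar> \<le> 16 * \<rho>" "\<bar>snd z - q\<bar> \<le> 16 * (\<rho> * s)" if "z \<in> D" for z
  proof -
    have nn: "k * (fst z - p)\<^sup>2 \<ge> 0" "m * (snd z - q)\<^sup>2 \<ge> 0"
      using km by auto
    have "k * (fst z - p)\<^sup>2 \<le> 256" "m * (snd z - q)\<^sup>2 \<le> 256"
      using that nn unfolding D_def Q_def mem_Collect_eq by linarith+
    then have "(fst z - p)\<^sup>2 \<le> (16 * \<rho>)\<^sup>2" "(snd z - q)\<^sup>2 \<le> (16 * (\<rho> * s))\<^sup>2"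
      using \<rho> s0 by (auto simp: k_def m_def field_simps)
    then show "\<bar>fst z - p\<bar> \<le> 16 * \<rho>" "\<bar>snd z - q\<bar> \<le> 16 * (\<rho> * s)"
      using \<rho> s0 by (simp_all only: power2_le_iff_abs_le mult_nonneg_nonneg zero_le_numeral less_imp_le)
  qed
  have DU: "D \<subseteq> U"
    using Dbd sub by blast
  have "closed D"
    unfolding D_def by (intro closed_Collect_le contQ continuous_intros)
  moreover have "D \<subseteq> cbox (p - 16 * \<rho>, q - 16 * (\<rho> * s)) (p + 16 * \<rho>, q + 16 * (\<rho> * s))"
    unfolding subset_iff mem_cbox_pair using Dbd by blast
  then have "bounded D"
    using bounded_cbox bounded_subset by blast
  ultimately have cD: "compact D"
    by (simp add: compact_eq_bounded_closed)
  have oG: "open G"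
    unfolding G_def by (intro open_Collect_less contQ continuous_intros)
  have GD: "G \<subseteq> D"
    by (auto simp: G_def D_def)
  \<comment> \<open>Distances to the pole are at most \<open>3 + 1/2 \<le> 4\<close> horizontal
    units \<open>\<rho>\<close> and \<open>9 + 1/2 \<le> 10\<close> vertical units
    \<open>\<rho> * s\<close>, and 16 + 100 is below 128.\<close>
  have z0Q: "Q z0 \<le> 128"
  proof -
    have "\<bar>fst z0 - fst x\<bar> < 3 * \<rho>" and b: "\<bar>snd z0 - snd x\<bar> < 3 * \<rho> * (\<bar>fst x\<bar> + 3 * \<rho>)"
      using z0(1) by (auto simp: gbox_def mem_rect)
    then have a: "\<bar>fst z0 - p\<bar> \<le> 4 * \<rho>"
      using p(1) \<rho> by linarith
    have "\<rho> * (\<bar>fst x\<bar> + 3 * \<rho>) \<le> \<rho> * (3 * s)"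
      using \<rho> s by (intro mult_left_mono) auto
    then have "3 * \<rho> * (\<bar>fst x\<bar> + 3 * \<rho>) \<le> 9 * (\<rho> * s)"
      by simp
    then have "\<bar>snd z0 - q\<bar> \<le> 10 * (\<rho> * s)"
      using b q \<rho>s by linarith
    then have "\<bar>snd z0 - q\<bar>\<^sup>2 \<le> (10 * (\<rho> * s))\<^sup>2" "\<bar>fst z0 - p\<bar>\<^sup>2 \<le> (4 * \<rho>)\<^sup>2"
      using a by (intro power_mono; simp)+
    then have "k * (fst z0 - p)\<^sup>2 \<le> 16" "m * (snd z0 - q)\<^sup>2 \<le> 100"
      using \<rho> s0 by (auto simp: k_def m_def field_simps)
    then show ?thesis by (simp add: Q_def)
  qed
  then have z0D: "z0 \<in> D"
    by (simp add: D_def)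

  \<comment> \<open>The barrier vanishes on \<open>Q = 256\<close>, is at most \<open>T * l\<close>
    everywhere and at least \<open>2 * l\<close> at \<open>z0\<close>. Hence \<open>w\<close> is
    nonnegative on the boundary of the ellipse and at most \<open>- l\<close> at
    \<open>z0\<close>.\<close>
  define \<psi> where "\<psi> = (\<lambda>z. T * l * (g z - exp (- 256 * \<alpha>)))"
  define w where "w = (\<lambda>z. u z - \<psi> z)"
  have \<psi>le: "\<psi> z \<le> T * l" for z
  proof -
    have "g z - exp (- 256 * \<alpha>) \<le> 1"
      using g01[of z] exp_gt_zero[of "- 256 * \<alpha>"] by linarith
    then show ?thesis
      using T0 l mult_left_mono[of _ 1 "T * l"] by (simp add: \<psi>_def)
  qed
  have low: "w z0 \<le> - l"
  proof -
    have "exp (- 128 * \<alpha>) \<le> g z0"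
      using z0Q \<alpha> by (simp add: g)
    then have "T * l * (exp (- 128 * \<alpha>) - exp (- 256 * \<alpha>)) \<le> \<psi> z0"
      using T0 l by (auto simp: \<psi>_def intro: mult_left_mono)
    moreover have "T * l * (exp (- 128 * \<alpha>) - exp (- 256 * \<alpha>))
        = T * (exp (- 128 * \<alpha>) - exp (- 256 * \<alpha>)) * l"
      by (simp only: mult_ac)
    ultimately show ?thesis
      using z0(2) unfolding w_def T2 by linarith
  qed
  have bd: "w z \<ge> 0" if "z \<in> D - G" for z
  proof -
    have "Q z = 256"
      using that by (auto simp: D_def G_def)
    then have "\<psi> z = 0"
      by (simp add: \<psi>_def g mult.commute)
    then show ?thesis
      using u0[of z] DU that by (auto simp: w_def)
  qed

  have C1: "C1_on U u" "C1_on U (pd1 u)" "C1_on U (pd2 u)"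
    using C2 by (auto simp: C2_on_def)
  define g1 g2 g11 g12 g22 where
    "g1 = (\<lambda>z. - 2 * \<alpha> * k * (fst z - p) * g z)" and
    "g2 = (\<lambda>z. - 2 * \<alpha> * m * (snd z - q) * g z)" and
    "g11 = (\<lambda>z. ((2 * \<alpha> * k * (fst z - p))\<^sup>2 - 2 * \<alpha> * k) * g z)" and
    "g12 = (\<lambda>z. 4 * \<alpha>\<^sup>2 * k * m * (fst z - p) * (snd z - q) * g z)" and
    "g22 = (\<lambda>z. ((2 * \<alpha> * m * (snd z - q))\<^sup>2 - 2 * \<alpha> * m) * g z)"
  have gd: "((\<lambda>z. g z - exp (- 256 * \<alpha>)) has_derivative (\<lambda>h. fst h * g1 z + snd h * g2 z)) (at z)" for z
    using has_derivative_diff[OF gauss_has_derivative[of \<alpha> p q k m z] has_derivative_const]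
    by (simp add: g_def g1_def g2_def)
  have g1d: "(g1 has_derivative (\<lambda>h. fst h * g11 z + snd h * g12 z)) (at z)"
    and g2d: "(g2 has_derivative (\<lambda>h. fst h * g12 z + snd h * g22 z)) (at z)" for z
    unfolding g1_def g2_def g11_def g12_def g22_def g_def
    by (rule gauss_second_derivatives)+
  have gcont: "continuous_on A g" for A
  proof -
    have "g = (\<lambda>z. exp (- \<alpha> * Q z))"
      by (simp add: fun_eq_iff g)
    then show ?thesis
      by (simp only:) (intro continuous_intros contQ)
  qed
  define w1 w2 w11 w12 w22 where
    "w1 = (\<lambda>z. pd1 u z - T * l * g1 z)" and
    "w2 = (\<lambda>z. pd2 u z - T * l * g2 z)" and
    "w11 = (\<lambda>z. pd1 (pd1 u) z - T * l * g11 z)" and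
    "w12 = (\<lambda>z. pd2 (pd1 u) z - T * l * g12 z)" and
    "w22 = (\<lambda>z. pd2 (pd2 u) z - T * l * g22 z)"
  have wd: "(w has_derivative (\<lambda>h. fst h * w1 z + snd h * w2 z)) (at z)" if "z \<in> U" for z
    unfolding w_def \<psi>_def w1_def w2_def
    by (rule has_derivative_diff_cmult[OF C1_on_has_derivative[OF C1(1) U that] gd])
  have w1d: "(w1 has_derivative (\<lambda>h. fst h * w11 z + snd h * w12 z)) (at z)" if "z \<in> U" for z
    unfolding w1_def w11_def w12_def
    by (rule has_derivative_diff_cmult[OF C1_on_has_derivative[OF C1(2) U that] g1d])
  \<comment> \<open>The mixed derivative \<open>pd1 (pd2 u)\<close> is exchanged for
    \<open>pd2 (pd1 u)\<close> so that the same \<open>w12\<close> serves both rows of the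
    Hessian.\<close>
  have w2d: "(w2 has_derivative (\<lambda>h. fst h * w12 z + snd h * w22 z)) (at z)" if "z \<in> U" for z
    unfolding w2_def w12_def w22_def pd_commute[OF C2 U that, symmetric]
    by (rule has_derivative_diff_cmult[OF C1_on_has_derivative[OF C1(3) U that] g2d])

  \<comment> \<open>\<open>P\<close> will bound the weighted trace
    \<open>w11 + t\<^sup>2 * w22\<close> at contact points, and \<open>B\<close> the determinant;
    676 is \<open>26\<^sup>2\<close>, from \<open>s \<le> 26 * \<bar>t\<bar>\<close> on
    \<open>K\<close>.\<close>
  define P where "P = 580 * T * \<alpha> * Lam * l / (lam * \<rho>\<^sup>2)"
  define B where "B = 676 * P\<^sup>2 / s\<^sup>2"
  define K where "K = cbox (p - \<rho> / 64, q - \<rho> * s / 64) (p + \<rho> / 64, q + \<rho> * s / 64)"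
  \<comment> \<open>Instead of the contact set itself, \<open>S\<close> collects all points of
    \<open>K\<close> obeying closed conditions that contact points will be shown to satisfy. It is
    therefore compact and carries the determinant bound by definition.\<close>
  define S where "S = {z \<in> K. u z \<le> T * l \<and> \<bar>w11 z * w22 z - w12 z * w12 z\<bar> \<le> B}"
  have Kmem: "z \<in> K \<longleftrightarrow> \<bar>fst z - p\<bar> \<le> \<rho> / 64 \<and> \<bar>snd z - q\<bar> \<le> \<rho> * s / 64" for z
    unfolding K_def by (rule mem_cbox_pair)
  have KU: "K \<subseteq> U"
  proof
    fix z assume "z \<in> K"
    then show "z \<in> U"
      using \<rho> \<rho>s unfolding Kmem by (intro sub) linarith+
  qed
  have ucont: "continuous_on K u"
    using C1_on_imp_continuous_on[OF C1(1) U] KU continuous_on_subset by blast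
  have detcont: "continuous_on K (\<lambda>z. w11 z * w22 z - w12 z * w12 z)"
    unfolding w11_def w12_def w22_def g11_def g12_def g22_def
    by (intro continuous_intros gcont
        continuous_on_subset[OF C1_on_continuous(1)[OF C1(2)] KU]
        continuous_on_subset[OF C1_on_continuous(2)[OF C1(2)] KU]
        continuous_on_subset[OF C1_on_continuous(2)[OF C1(3)] KU])
  have cS: "compact S"
  proof -
    have "closed K"
      by (simp add: K_def closed_cbox)
    have "compact K"
      by (simp add: K_def compact_cbox)
    moreover have "closed {z \<in> K. u z \<le> T * l}"
      by (rule continuous_on_closed_Collect_le[OF ucont continuous_on_const \<open>closed K\<close>])
    moreover have "closed {z \<in> K. \<bar>w11 z * w22 z - w12 z * w12 z\<bar> \<le> B}"
      by (rule continuous_on_closed_Collect_le[OF continuous_on_rabs[OF detcont]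
            continuous_on_const \<open>closed K\<close>])
    moreover have "S = K \<inter> ({z \<in> K. u z \<le> T * l} \<inter> {z \<in> K. \<bar>w11 z * w22 z - w12 z * w12 z\<bar> \<le> B})"
      by (auto simp: S_def)
    ultimately show ?thesis
      by (simp only: compact_Int_closed closed_Int)
  qed
  \<comment> \<open>Two points of \<open>D\<close> differ by at most \<open>32 * \<rho>\<close> and
    \<open>32 * (\<rho> * s)\<close>, so with a slope in \<open>V\<close> each term of the affine
    function is at most \<open>l / 4\<close>.\<close>
  define V where "V = rect (0, 0) (l / (128 * \<rho>)) (l / (128 * (\<rho> * s)))"
  have contact: "V \<subseteq> (\<lambda>z. (w1 z, w2 z)) ` S"
  proof
    fix v assume "v \<in> V"
    then have v: "\<bar>fst v\<bar> < l / (128 * \<rho>)" "\<bar>snd v\<bar> < l / (128 * (\<rho> * s))"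
      by (auto simp: V_def mem_rect)
    have slope: "fst v * (fst z - fst z0) + snd v * (snd z - snd z0) < l" if "z \<in> D" for z
    proof -
      have "\<bar>fst z - fst z0\<bar> \<le> 32 * \<rho>" "\<bar>snd z - snd z0\<bar> \<le> 32 * (\<rho> * s)"
        using Dbd[OF that] Dbd[OF z0D] by linarith+
      then have "\<bar>fst v\<bar> * \<bar>fst z - fst z0\<bar> \<le> l / (128 * \<rho>) * (32 * \<rho>)"
        "\<bar>snd v\<bar> * \<bar>snd z - snd z0\<bar> \<le> l / (128 * (\<rho> * s)) * (32 * (\<rho> * s))"
        using v by (intro mult_mono; simp)+
      then have "\<bar>fst v * (fst z - fst z0)\<bar> \<le> l / 4" "\<bar>snd v * (snd z - snd z0)\<bar> \<le> l / 4"
        using \<rho> s0 by (simp_all add: abs_mult)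
      then show ?thesis
        using l by linarith
    qed
    have wcont: "continuous_on D w"
      using DU by (intro continuous_at_imp_continuous_on ballI has_derivative_continuous[OF wd]) auto
    have GU: "G \<subseteq> U"
      using GD DU by blast
    note wdG = wd[OF subsetD[OF GU]] w1d[OF subsetD[OF GU]] w2d[OF subsetD[OF GU]]
    obtain z where z: "z \<in> G" "w1 z = fst v" "w2 z = snd v" "w z < 0"
      and psd': "\<forall>\<xi> \<zeta>. w11 z * \<xi>\<^sup>2 + 2 * w12 z * \<xi> * \<zeta> + w22 z * \<zeta>\<^sup>2 \<ge> 0"
      by (rule small_slope_attained[OF cD z0D oG GD wcont low bd wdG slope])
    note psd = psd'[rule_format]
    have zU: "z \<in> U" and zD: "z \<in> D"
      using z(1) GU GD by auto
    define t where "t = fst z"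
    define y where "y = snd z"
    \<comment> \<open>\<open>lg\<close> is the operator applied to the Gaussian at the contact
      point.\<close>
    define lg where "lg = a11 z * g11 z + 2 * a12 z * t * g12 z + a22 z * t\<^sup>2 * g22 z"
    have lo: "lam * (\<xi>\<^sup>2 + \<zeta>\<^sup>2) \<le> a11 z * \<xi>\<^sup>2 + 2 * a12 z * \<xi> * \<zeta> + a22 z * \<zeta>\<^sup>2"
      and up: "a11 z * \<xi>\<^sup>2 + 2 * a12 z * \<xi> * \<zeta> + a22 z * \<zeta>\<^sup>2 \<le> Lam * (\<xi>\<^sup>2 + \<zeta>\<^sup>2)" for \<xi> \<zeta>
      using ell by (simp_all add: ellipticity_constants_def del: split_paired_All)
    define E where "E = ((t - p) / \<rho>)\<^sup>2 + (t / s)\<^sup>2 * ((y - q) / (\<rho> * s))\<^sup>2"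
    have lg: "lg \<ge> \<alpha> / \<rho>\<^sup>2 * g z * (4 * \<alpha> * lam * E - 2 * Lam * (1 + (t / s)\<^sup>2))"
      unfolding lg_def g11_def g12_def g22_def t_def y_def E_def k_def m_def
      by (rule gauss_grushin_lower[OF lo up]) (use \<alpha> \<rho> s0 g01[of z] in auto)
    have tp: "\<bar>t - p\<bar> \<le> 16 * \<rho>"
      using Dbd[OF zD] by (simp add: t_def)
    note bounds = barrier_coefficient_bounds[OF \<rho> s p tp]
    have "Lam * (1 + (t / s)\<^sup>2) \<le> Lam * 290"
      using bounds(1) Lam by (intro mult_left_mono) auto
    then have "\<alpha> / \<rho>\<^sup>2 * g z * (4 * \<alpha> * lam * E - 2 * Lam * (1 + (t / s)\<^sup>2))
        \<ge> \<alpha> / \<rho>\<^sup>2 * g z * (4 * \<alpha> * lam * E - 580 * Lam)"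
      using \<alpha> g01[of z] by (intro mult_left_mono) auto
    with lg have lg': "lg \<ge> \<alpha> / \<rho>\<^sup>2 * g z * (4 * \<alpha> * lam * E - 580 * Lam)"
      by linarith
    \<comment> \<open>The Hessian of \<open>w\<close> is positive semidefinite here, so its weighted
      trace is controlled by the operator on \<open>w\<close>; as the operator is nonpositive on
      \<open>u\<close>, only the barrier remains.\<close>
    have tr: "lam * (w11 z + t\<^sup>2 * w22 z) \<le> - (T * l * lg)"
    proof -
      have "lam * (w11 z + t\<^sup>2 * w22 z) \<le> a11 z * w11 z + 2 * a12 z * t * w12 z + a22 z * t\<^sup>2 * w22 z"
        by (rule elliptic_trace_lower[OF lo psd])
      also have "\<dots> = grushin_op a11 a12 a22 u z - T * l * lg"
        unfolding grushin_op_eq[OF C2 zU]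
        by (simp add: w11_def w12_def w22_def lg_def t_def algebra_simps)
      finally show ?thesis
        using Lu[OF zU] by linarith
    qed
    note W = psd_coeffs[OF psd]
    have tr0: "lam * (w11 z + t\<^sup>2 * w22 z) \<ge> 0"
      using W lam by simp
    have "T * l > 0"
      using T0 l by simp
    then have lgneg: "lg \<le> 0"
      using tr tr0 mult_pos_pos[of "T * l" lg] by argo
    \<comment> \<open>Outside \<open>K\<close> the barrier is a strict subsolution, against
      \<open>lgneg\<close>: the number 580 is \<open>2 * (1 + 289)\<close>, and
      \<open>10 ^ 9 / 2768896\<close> exceeds 145, a quarter of it.\<close>
    have zK: "z \<in> K"
    proof (rule ccontr)
      assume "z \<notin> K"
      then have far: "\<bar>t - p\<bar> > \<rho> / 64 \<or> \<bar>y - q\<bar> > \<rho> * s / 64"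
        by (auto simp: Kmem t_def y_def)
      have "10 ^ 9 * Lam * (1 / 2768896) \<le> \<alpha> * lam * E"
        using bounds(3)[OF far] \<alpha> lam by (intro mult_mono[OF \<alpha>(2)]) (simp_all add: E_def)
      moreover have "4 * \<alpha> * lam * E = 4 * (\<alpha> * lam * E)"
        by simp
      moreover have "145 * Lam < 10 ^ 9 * Lam * (1 / 2768896)"
        using Lam by simp
      ultimately have "4 * \<alpha> * lam * E - 580 * Lam > 0"
        by linarith
      then have "\<alpha> / \<rho>\<^sup>2 * g z * (4 * \<alpha> * lam * E - 580 * Lam) > 0"
        using \<alpha> \<rho> g01[of z] by simp
      then show False
        using lg' lgneg by linarith
    qed
    have "\<alpha> / \<rho>\<^sup>2 * g z * (580 * Lam) \<le> \<alpha> / \<rho>\<^sup>2 * 1 * (580 * Lam)"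
      using \<alpha> g01[of z] Lam by (intro mult_right_mono mult_left_mono) auto
    moreover have "\<alpha> / \<rho>\<^sup>2 * g z * (4 * \<alpha> * lam * E) \<ge> 0"
      using \<alpha> g01[of z] lam by (simp add: E_def)
    ultimately have "- lg \<le> \<alpha> / \<rho>\<^sup>2 * (580 * Lam)"
      using lg' by (simp add: right_diff_distrib)
    then have "T * l * (- lg) \<le> T * l * (\<alpha> / \<rho>\<^sup>2 * (580 * Lam))"
      using T0 l by (intro mult_left_mono) auto
    moreover have "T * l * (\<alpha> / \<rho>\<^sup>2 * (580 * Lam)) = lam * P"
      using lam by (simp add: P_def)
    moreover have "T * l * (- lg) = - (T * l * lg)"
      by simp
    ultimately have "lam * (w11 z + t\<^sup>2 * w22 z) \<le> lam * P"
      using tr by linarith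
    then have trP: "w11 z + t\<^sup>2 * w22 z \<le> P"
      using lam by simp
    have "\<bar>w11 z * w22 z - w12 z * w12 z\<bar> \<le> w11 z * w22 z"
      using W by (simp add: power2_eq_square)
    also have "\<dots> \<le> B"
    proof -
      have "w11 z \<le> P" "t\<^sup>2 * w22 z \<le> P"
        using trP W(1) mult_nonneg_nonneg[OF zero_le_power2[of t] W(2)] by linarith+
      then have m1: "w11 z * (t\<^sup>2 * w22 z) \<le> P * P"
        using W by (intro mult_mono) auto
      \<comment> \<open>On \<open>K\<close> the weight \<open>t\<^sup>2\<close> is comparable to
        \<open>s\<^sup>2\<close>, so the bound on \<open>w11 * (t\<^sup>2 * w22)\<close> becomes one
        on the unweighted product.\<close>
      have "s \<le> 26 * \<bar>t\<bar>"
        using zK by (intro bounds(2)) (simp add: Kmem t_def)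
      then have "s\<^sup>2 \<le> (26 * \<bar>t\<bar>)\<^sup>2"
        using s0 by (intro power_mono) auto
      then have "s\<^sup>2 \<le> 676 * t\<^sup>2"
        by (simp add: power_mult_distrib)
      then have "s\<^sup>2 * (w11 z * w22 z) \<le> 676 * t\<^sup>2 * (w11 z * w22 z)"
        using W by (intro mult_right_mono) auto
      also have "\<dots> \<le> 676 * (P * P)"
        using m1 by (simp add: algebra_simps)
      finally show ?thesis
        using s0 by (simp add: B_def field_simps power2_eq_square)
    qed
    finally have "\<bar>w11 z * w22 z - w12 z * w12 z\<bar> \<le> B" .
    moreover have "u z \<le> T * l"
      using z(4) \<psi>le[of z] by (simp add: w_def)
    ultimately have "z \<in> S"
      using zK by (simp add: S_def)
    then show "v \<in> (\<lambda>z. (w1 z, w2 z)) ` S"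
      using z(2,3) by (intro image_eqI[of _ _ z]) simp_all
  qed
  have SU: "S \<subseteq> U"
    using KU by (auto simp: S_def)
  have "measure lebesgue V \<le> B * measure lebesgue S"
  proof (rule measure_image_jacobian_le[of S w1 w11 w12 w2 w12 w22 B V, OF cS])
    show "continuous_on S (\<lambda>z. w11 z * w22 z - w12 z * w12 z)"
      using detcont by (rule continuous_on_subset) (auto simp: S_def)
    show "V \<in> sets borel"
      by (simp add: V_def open_rect borel_open)
    show "V \<subseteq> (\<lambda>z. (w1 z, w2 z)) ` S"
      by (rule contact)
    fix z assume z: "z \<in> S"
    show "(w1 has_derivative (\<lambda>h. fst h * w11 z + snd h * w12 z)) (at z)"
      "(w2 has_derivative (\<lambda>h. fst h * w12 z + snd h * w22 z)) (at z)"
      by (rule w1d[OF subsetD[OF SU z]], rule w2d[OF subsetD[OF SU z]])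
    show "\<bar>w11 z * w22 z - w12 z * w12 z\<bar> \<le> B"
      using z by (simp add: S_def)
  qed
  moreover have "measure lebesgue V = l\<^sup>2 / (4096 * \<rho>\<^sup>2 * s)"
    unfolding V_def using \<rho> s0 l by (subst measure_rect) (auto simp: power2_eq_square)
  ultimately have V: "l\<^sup>2 / (4096 * \<rho>\<^sup>2 * s) \<le> B * measure lebesgue S"
    by simp
  have B0: "B > 0"
    using T0 \<alpha> Lam lam l \<rho> s0 by (auto simp: B_def P_def)
  \<comment> \<open>The area of \<open>V\<close> and the bound \<open>B\<close> are both quadratic
    in \<open>l\<close>, so the level cancels.\<close>
  have "lam\<^sup>2 * \<rho>\<^sup>2 * s / (4096 * 676 * (580 * T * \<alpha> * Lam)\<^sup>2) = l\<^sup>2 / (4096 * \<rho>\<^sup>2 * s) / B"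
    using T0 \<alpha> Lam lam l \<rho> s0 by (simp add: B_def P_def field_simps power2_eq_square)
  also have "\<dots> \<le> measure lebesgue S"
    using V by (simp only: pos_divide_le_eq[OF B0] mult.commute)
  also have "\<dots> \<le> measure lebesgue ({z. u z \<le> T * l} \<inter> rect (p, q) (\<rho> / 32) (\<rho> * s / 32))"
  proof (rule measure_mono_fmeasurable)
    show "S \<subseteq> {z. u z \<le> T * l} \<inter> rect (p, q) (\<rho> / 32) (\<rho> * s / 32)"
    proof
      fix z assume z: "z \<in> S"
      then have "\<bar>fst z - p\<bar> < \<rho> / 32" "\<bar>snd z - q\<bar> < \<rho> * s / 32"
        using \<rho> \<rho>s unfolding S_def mem_Collect_eq Kmem by linarith+
      with z show "z \<in> {z. u z \<le> T * l} \<inter> rect (p, q) (\<rho> / 32) (\<rho> * s / 32)"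
        by (simp add: S_def mem_rect)
    qed
    show "S \<in> sets lebesgue"
      by (rule fmeasurableD[OF lmeasurable_compact[OF cS]])
    let ?R = "rect (p, q) (\<rho> / 32) (\<rho> * s / 32)"
    have "?R \<subseteq> U"
    proof
      fix z assume "z \<in> ?R"
      then show "z \<in> U"
        using \<rho> \<rho>s unfolding mem_rect fst_conv snd_conv by (intro sub) linarith+
    qed
    then have "continuous_on ?R u"
      by (rule continuous_on_subset[OF C1_on_imp_continuous_on[OF C1(1) U]])
    then show "{z. u z \<le> T * l} \<inter> ?R \<in> lmeasurable"
      by (rule lmeasurable_sublevel[OF _ lmeasurable_rect])
  qed
  finally show ?thesis .
qed

section \<open>Boxes and the decay of super-level sets\<close>

lemma mem_gbox: "z \<in> gbox x r \<longleftrightarrow> \<bar>fst z - fst x\<bar> < r \<and> \<bar>snd z - snd x\<bar> < r * (\<bar>fst x\<bar> + r)"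
  by (simp add: gbox_def mem_rect)

lemma open_gbox: "open (gbox x r)"
  by (simp add: gbox_def open_rect)

lemma lmeasurable_gbox [simp]: "gbox x r \<in> lmeasurable"
  by (simp add: gbox_def)

lemma measure_gbox: "r \<ge> 0 \<Longrightarrow> measure lebesgue (gbox x r) = 4 * r\<^sup>2 * (\<bar>fst x\<bar> + r)"
  by (simp add: gbox_def measure_rect power2_eq_square)

lemma centre_in_gbox: "r > 0 \<Longrightarrow> x \<in> gbox x r"
  by (simp add: mem_gbox add_nonneg_pos)

lemma measure_gbox_triple:
  assumes "r > 0"
  shows "measure lebesgue (gbox x (3 * r)) \<le> 27 * measure lebesgue (gbox x r)"
proof -
  have "36 * r\<^sup>2 * (\<bar>fst x\<bar> + 3 * r) \<le> 36 * r\<^sup>2 * (3 * (\<bar>fst x\<bar> + r))"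
    by (intro mult_left_mono) auto
  then show ?thesis
    using assms by (simp add: measure_gbox power_mult_distrib)
qed

lemma gbox_mono:
  assumes "r \<le> r'" "r > 0"
  shows "gbox x r \<subseteq> gbox x r'"
proof -
  have "r * (\<bar>fst x\<bar> + r) \<le> r' * (\<bar>fst x\<bar> + r')"
    using assms by (intro mult_mono) auto
  then show ?thesis
    using assms by (auto simp: subset_iff mem_gbox)
qed

text \<open>The height of a box depends on its centre. Here the centres differ horizontally by less
  than \<open>2 * r\<close>, so the smaller box has half-height at most
  \<open>r * (\<bar>fst x\<bar> + 3 * r)\<close>, which is spent twice on the way from the common
  point to \<open>y\<close>.\<close>

lemma gbox_engulf:
  assumes r: "0 < r'" "r' \<le> r" and meet: "z \<in> gbox x r" "z \<in> gbox x' r'"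
  shows "gbox x' r' \<subseteq> gbox x (3 * r)"
proof
  fix y assume y: "y \<in> gbox x' r'"
  have 1: "\<bar>fst y - fst x\<bar> < 3 * r" "\<bar>fst x'\<bar> \<le> \<bar>fst x\<bar> + 2 * r"
    using r meet y unfolding mem_gbox by linarith+
  have "r' * (\<bar>fst x'\<bar> + r') \<le> r * (\<bar>fst x\<bar> + 3 * r)"
    using r 1 by (intro mult_mono) auto
  then have "\<bar>snd y - snd x\<bar> < r * (\<bar>fst x\<bar> + r) + 2 * (r * (\<bar>fst x\<bar> + 3 * r))"
    using meet y unfolding mem_gbox by linarith
  also have "\<dots> \<le> 3 * r * (\<bar>fst x\<bar> + 3 * r)"
    using r by (simp add: algebra_simps)
  finally show "y \<in> gbox x (3 * r)"
    using 1 by (simp add: mem_gbox)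
qed

section \<open>Vitali covering and the measure comparison\<close>

text \<open>Greedy choice: take a box of maximal radius, discard all boxes meeting it, since its
  triple engulfs them, and recurse on the rest.\<close>

lemma gbox_Vitali_finite:
  assumes "finite I" "\<And>x. x \<in> I \<Longrightarrow> \<rho> x > 0"
  shows "\<exists>J\<subseteq>I. (\<forall>x\<in>J. \<forall>y\<in>J. x \<noteq> y \<longrightarrow> gbox x (\<rho> x) \<inter> gbox y (\<rho> y) = {}) \<and>
    (\<forall>x\<in>I. \<exists>y\<in>J. gbox x (\<rho> x) \<subseteq> gbox y (3 * \<rho> y))"
  using assms
proof (induction I rule: finite_psubset_induct)
  case (psubset I)
  show ?case
  proof (cases "I = {}")
    case False
    then have "Max (\<rho> ` I) \<in> \<rho> ` I"
      using psubset.hyps by (intro Max_in) auto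
    then obtain m where m: "m \<in> I" "\<rho> m = Max (\<rho> ` I)"
      by force
    have max: "\<rho> x \<le> \<rho> m" if "x \<in> I" for x
      unfolding m(2) using psubset.hyps that by (intro Max_ge) auto
    define I' where "I' = {x \<in> I. gbox x (\<rho> x) \<inter> gbox m (\<rho> m) = {}}"
    have mpos: "\<rho> m > 0"
      using psubset.prems m(1) by blast
    have "m \<notin> I'"
      using centre_in_gbox[OF mpos, of m] by (auto simp: I'_def)
    then have I': "I' \<subset> I"
      using m(1) by (auto simp: I'_def)
    have "\<rho> x > 0" if "x \<in> I'" for x
      using that psubset.prems I' by blast
    from psubset.IH[OF I' this] obtain J where J: "J \<subseteq> I'"
      "\<forall>x\<in>J. \<forall>y\<in>J. x \<noteq> y \<longrightarrow> gbox x (\<rho> x) \<inter> gbox y (\<rho> y) = {}"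
      "\<forall>x\<in>I'. \<exists>y\<in>J. gbox x (\<rho> x) \<subseteq> gbox y (3 * \<rho> y)"
      by blast
    have "\<exists>y\<in>insert m J. gbox x (\<rho> x) \<subseteq> gbox y (3 * \<rho> y)" if xI: "x \<in> I" for x
    proof (cases "x \<in> I'")
      case True
      then show ?thesis using J(3) by blast
    next
      case F: False
      then obtain z where "z \<in> gbox m (\<rho> m)" "z \<in> gbox x (\<rho> x)"
        using xI unfolding I'_def by blast
      then have "gbox x (\<rho> x) \<subseteq> gbox m (3 * \<rho> m)"
        using gbox_engulf[OF psubset.prems[OF xI] max[OF xI]] by blast
      then show ?thesis by blast
    qed
    moreover have "\<forall>x\<in>insert m J. \<forall>y\<in>insert m J. x \<noteq> y \<longrightarrow> gbox x (\<rho> x) \<inter> gbox y (\<rho> y) = {}"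
      using J(1,2) by (auto simp: I'_def)
    moreover have "insert m J \<subseteq> I"
      using J(1) m(1) by (auto simp: I'_def)
    ultimately show ?thesis by blast
  qed auto
qed

text \<open>Inner regularity; it reduces the covering argument to finitely many boxes.\<close>

lemma measure_le_of_compact_subsets:
  fixes E :: "(real \<times> real) set"
  assumes E: "E \<in> lmeasurable" "bounded E"
    and C: "\<And>C. compact C \<Longrightarrow> C \<subseteq> E \<Longrightarrow> measure lebesgue C \<le> b"
  shows "measure lebesgue E \<le> b"
proof (rule field_le_epsilon)
  fix e :: real assume e: "e > 0"
  obtain C where C': "closed C" "C \<subseteq> E" "E - C \<in> lmeasurable" "emeasure lebesgue (E - C) < ennreal e"
    using sets_lebesgue_inner_closed[OF fmeasurableD[OF E(1)] e] by metis
  have "compact C"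
    using C' E(2) bounded_subset compact_eq_bounded_closed by blast
  then have "measure lebesgue C \<le> b" and mC: "C \<in> lmeasurable"
    using C C'(2) lmeasurable_compact by blast+
  moreover have "measure lebesgue (E - C) \<le> e"
    using C'(3,4) e by (simp add: emeasure_eq_measure2 ennreal_less_iff)
  moreover have "measure lebesgue (E - C) = measure lebesgue E - measure lebesgue C"
    using measurable_measure_Diff[OF E(1) fmeasurableD[OF mC] C'(2)] .
  ultimately show "measure lebesgue E \<le> b + e"
    by linarith
qed

text \<open>A compact part of \<open>E\<close> is covered by the triples of finitely many disjoint
  boxes, at a cost of 27 in area. Each box pays with \<open>N x - E\<close>, and these sets are
  disjoint parts of \<open>F - E\<close>.\<close>

lemma ink_spots:
  fixes \<rho> :: "real \<times> real \<Rightarrow> real" and N :: "real \<times> real \<Rightarrow> (real \<times> real) set"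
  assumes E: "E \<in> lmeasurable" "bounded E" and F: "F \<in> lmeasurable" and \<delta>: "\<delta> > 0"
    and \<rho>: "\<And>x. x \<in> E \<Longrightarrow> \<rho> x > 0"
    and N: "\<And>x. x \<in> E \<Longrightarrow> N x \<in> lmeasurable" "\<And>x. x \<in> E \<Longrightarrow> N x \<subseteq> F \<inter> gbox x (\<rho> x)"
    and big: "\<And>x. x \<in> E \<Longrightarrow> \<delta> * measure lebesgue (gbox x (\<rho> x)) \<le> measure lebesgue (N x - E)"
  shows "measure lebesgue E \<le> 27 / \<delta> * measure lebesgue (F - E)"
proof (rule measure_le_of_compact_subsets[OF E])
  fix C assume C: "compact C" "C \<subseteq> E"
  have "C \<subseteq> (\<Union>x\<in>C. gbox x (\<rho> x))"
    using centre_in_gbox \<rho> C by blast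
  then obtain I where I: "I \<subseteq> C" "finite I" "C \<subseteq> (\<Union>x\<in>I. gbox x (\<rho> x))"
    using compactE_image[OF C(1), of C "\<lambda>x. gbox x (\<rho> x)"] open_gbox by metis
  have IE: "I \<subseteq> E"
    using I C by blast
  obtain J where J: "J \<subseteq> I"
    "\<forall>x\<in>J. \<forall>y\<in>J. x \<noteq> y \<longrightarrow> gbox x (\<rho> x) \<inter> gbox y (\<rho> y) = {}"
    "\<forall>x\<in>I. \<exists>y\<in>J. gbox x (\<rho> x) \<subseteq> gbox y (3 * \<rho> y)"
    using gbox_Vitali_finite[OF I(2), of \<rho>] \<rho> IE by blast
  have fJ: "finite J" and JE: "J \<subseteq> E"
    using J I IE finite_subset by blast+
  have NE: "N x - E \<in> lmeasurable" if "x \<in> J" for x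
    by (intro fmeasurable_Diff N(1) fmeasurableD[OF E(1)] subsetD[OF JE that])
  have "C \<subseteq> (\<Union>y\<in>J. gbox y (3 * \<rho> y))"
    using I(3) J(3) by blast
  then have "measure lebesgue C \<le> measure lebesgue (\<Union>y\<in>J. gbox y (3 * \<rho> y))"
    using fJ C(1) lmeasurable_compact
    by (intro measure_mono_fmeasurable fmeasurable.finite_UN) (auto intro: fmeasurableD)
  also have "\<dots> \<le> (\<Sum>y\<in>J. measure lebesgue (gbox y (3 * \<rho> y)))"
    using fJ by (intro measure_UNION_le) (auto intro: fmeasurableD)
  also have "\<dots> \<le> (\<Sum>y\<in>J. 27 / \<delta> * measure lebesgue (N y - E))"
  proof (rule sum_mono)
    fix y assume "y \<in> J"
    then have y: "y \<in> E" "\<rho> y > 0"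
      using JE \<rho> by blast+
    have "measure lebesgue (gbox y (3 * \<rho> y)) \<le> 27 * measure lebesgue (gbox y (\<rho> y))"
      by (rule measure_gbox_triple[OF y(2)])
    also have "\<dots> = 27 / \<delta> * (\<delta> * measure lebesgue (gbox y (\<rho> y)))"
      using \<delta> by simp
    also have "\<dots> \<le> 27 / \<delta> * measure lebesgue (N y - E)"
      using big[OF y(1)] \<delta> by (intro mult_left_mono) auto
    finally show "measure lebesgue (gbox y (3 * \<rho> y)) \<le> 27 / \<delta> * measure lebesgue (N y - E)" .
  qed
  also have "\<dots> = 27 / \<delta> * (\<Sum>y\<in>J. measure lebesgue (N y - E))"
    by (simp only: sum_distrib_left)
  also have "(\<Sum>y\<in>J. measure lebesgue (N y - E)) = measure lebesgue (\<Union>y\<in>J. N y - E)"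
  proof (rule measure_UNION'[symmetric, OF fJ NE])
    show "pairwise (\<lambda>x y. disjnt (N x - E) (N y - E)) J"
      unfolding pairwise_def disjnt_def using J(2) N(2) JE by blast
  qed
  also have "27 / \<delta> * \<dots> \<le> 27 / \<delta> * measure lebesgue (F - E)"
  proof (intro mult_left_mono measure_mono_fmeasurable)
    show "(\<Union>y\<in>J. N y - E) \<subseteq> F - E"
      using N(2) JE by blast
    show "(\<Union>y\<in>J. N y - E) \<in> sets lebesgue"
      using fJ NE by (intro sets.finite_UN) (auto intro: fmeasurableD)
    show "F - E \<in> lmeasurable"
      using F E(1) by (intro fmeasurable_Diff) auto
  qed (use \<delta> in auto)
  finally show "measure lebesgue C \<le> 27 / \<delta> * measure lebesgue (F - E)" .
qed

lemma bounded_gbox: "bounded (gbox x r)"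
  by (simp add: gbox_def rect_eq_box)

text \<open>Dyadic radii are used so that the stopping argument can run over the natural
  numbers.\<close>

lemma small_gbox_subset:
  assumes "open E" "x \<in> E" "R > 0"
  obtains n where "gbox x (R / 2 ^ n) \<subseteq> E"
proof -
  obtain e where e: "e > 0" "ball x e \<subseteq> E"
    using openE assms by blast
  define K where "K = 1 + (\<bar>fst x\<bar> + R)"
  have K: "K > 0"
    using assms by (simp add: K_def add_pos_nonneg)
  obtain n where n: "(1 / 2) ^ n < e / (R * K)"
    using real_arch_pow_inv[of "e / (R * K)" "1 / 2"] e assms K by auto
  define r where "r = R / 2 ^ n"
  have r: "r > 0" "r \<le> R" "r * K < e"
    using assms n K by (auto simp: r_def field_simps power_divide)
  have "gbox x r \<subseteq> ball x e"
  proof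
    fix z assume z: "z \<in> gbox x r"
    have "dist z x \<le> \<bar>fst z - fst x\<bar> + \<bar>snd z - snd x\<bar>"
      by (simp add: dist_prod_def dist_real_def sqrt_sum_squares_le_sum_abs)
    also have "\<dots> < r + r * (\<bar>fst x\<bar> + r)"
      using z by (auto simp: mem_gbox)
    also have "\<dots> \<le> r + r * (\<bar>fst x\<bar> + R)"
      using r by (intro add_left_mono mult_left_mono) auto
    also have "\<dots> = r * K"
      by (simp add: K_def algebra_simps)
    finally show "z \<in> ball x e"
      using r by (simp add: dist_commute)
  qed
  then show thesis
    using e that[of n] by (auto simp: r_def)
qed

text \<open>With \<open>E\<close> and \<open>F\<close> the sets above \<open>T * l\<close> and
  \<open>l\<close>, the covering estimate gives \<open>\<bar>E\<bar> \<le> 27 / \<delta> *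
  (\<bar>F\<bar> - \<bar>E\<bar>)\<close>, bars denoting measure; solving for the measure of
  \<open>E\<close> produces the factor \<open>27 / (27 + \<delta>)\<close>.\<close>

lemma decay_step:
  fixes u :: "real \<times> real \<Rightarrow> real"
  assumes R: "R > 0" and \<Omega>: "\<Omega> = gbox y R" and cont: "continuous_on \<Omega> u"
    and \<delta>: "\<delta> > 0" and T: "T \<ge> 1" and l: "l > 0"
    and N: "\<And>x \<rho>. x \<in> \<Omega> \<Longrightarrow> 0 < \<rho> \<Longrightarrow> \<rho> \<le> R \<Longrightarrow> N x \<rho> \<in> lmeasurable \<and> N x \<rho> \<subseteq> \<Omega> \<inter> gbox x \<rho>"
    and dens: "\<And>x \<rho> z. x \<in> \<Omega> \<Longrightarrow> 0 < \<rho> \<Longrightarrow> \<rho> \<le> R \<Longrightarrow> z \<in> gbox x (3 * \<rho>) \<Longrightarrow> u z \<le> l \<Longrightarrow>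
      \<delta> * measure lebesgue (gbox x \<rho>) \<le> measure lebesgue ({z. u z \<le> T * l} \<inter> N x \<rho>)"
    and start: "\<And>x. x \<in> \<Omega> \<Longrightarrow> \<exists>z\<in>gbox x (3 * R). u z \<le> l"
  shows "measure lebesgue {z \<in> \<Omega>. u z > T * l}
    \<le> 27 / (27 + \<delta>) * measure lebesgue {z \<in> \<Omega>. u z > l}"
proof -
  define E where "E = {z \<in> \<Omega>. u z > T * l}"
  define F where "F = {z \<in> \<Omega>. u z > l}"
  have opn: "open {z \<in> \<Omega>. u z > c}" for c
  proof -
    have "{z \<in> \<Omega>. u z > c} = \<Omega> \<inter> u -` {c<..}"
      by auto
    then show ?thesis
      using continuous_open_preimage[OF cont _ open_greaterThan] by (simp add: \<Omega> open_gbox)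
  qed
  have meas: "{z \<in> \<Omega>. u z > c} \<in> lmeasurable" for c
  proof (rule lmeasurable_open[OF _ opn])
    show "bounded {z \<in> \<Omega>. u z > c}"
      by (rule bounded_subset[OF bounded_gbox[of y R]]) (auto simp: \<Omega>)
  qed
  have oE: "open E" and mE: "E \<in> lmeasurable" and mF: "F \<in> lmeasurable"
    using opn meas by (auto simp: E_def F_def)
  have bE: "bounded E"
    by (rule bounded_subset[OF bounded_gbox[of y R]]) (auto simp: \<Omega> E_def)
  have "l \<le> T * l"
    using T l by simp
  then have EF: "E \<subseteq> F"
    by (auto simp: E_def F_def)
  have "\<exists>\<rho>. 0 < \<rho> \<and> \<rho> \<le> R \<and> N x \<rho> \<subseteq> F \<and> \<delta> * measure lebesgue (gbox x \<rho>) \<le> measure lebesgue (N x \<rho> - E)"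
    if x: "x \<in> E" for x
  proof -
    have x\<Omega>: "x \<in> \<Omega>"
      using x by (simp add: E_def)
    \<comment> \<open>Stop at a dyadic scale at which \<open>N\<close> sees a proportion of the complement of \<open>E\<close>, the next finer
      scale no longer does.\<close>
    define P where "P = (\<lambda>n. \<delta> * measure lebesgue (gbox x (R / 2 ^ n))
      \<le> measure lebesgue (N x (R / 2 ^ n) - E))"
    have \<rho>n: "0 < R / 2 ^ n" "R / 2 ^ n \<le> R" for n
      using R by (auto simp: divide_le_eq)
    have dens': "P n" if "z \<in> gbox x (3 * (R / 2 ^ n))" "u z \<le> l" for n z
    proof -
      note Nn = N[OF x\<Omega> \<rho>n, of n]
      have "measure lebesgue ({z. u z \<le> T * l} \<inter> N x (R / 2 ^ n)) \<le> measure lebesgue (N x (R / 2 ^ n) - E)"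
      proof (rule measure_mono_fmeasurable)
        have "continuous_on (N x (R / 2 ^ n)) u"
          using Nn cont continuous_on_subset by blast
        then show "{z. u z \<le> T * l} \<inter> N x (R / 2 ^ n) \<in> sets lebesgue"
          using Nn lmeasurable_sublevel fmeasurableD by blast
        show "N x (R / 2 ^ n) - E \<in> lmeasurable"
          using Nn mE by (intro fmeasurable_Diff) auto
      qed (auto simp: E_def)
      with dens[OF x\<Omega> \<rho>n that] show ?thesis
        unfolding P_def by linarith
    qed
    \<comment> \<open>The largest scale succeeds by \<open>start\<close>. Once the box lies in the
      open set \<open>E\<close>, the set \<open>N - E\<close> is empty and \<open>P\<close> fails,
      so some success is directly followed by a failure.\<close>
    have "P 0"
      using start[OF x\<Omega>] dens'[of _ 0] by auto
    moreover have "\<exists>n. \<not> P n"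
    proof -
      obtain n where n: "gbox x (R / 2 ^ n) \<subseteq> E"
        using small_gbox_subset[OF oE x R] by blast
      then have "N x (R / 2 ^ n) - E = {}"
        using N[OF x\<Omega> \<rho>n, of n] by blast
      moreover have "\<delta> * measure lebesgue (gbox x (R / 2 ^ n)) > 0"
        using \<delta> \<rho>n[of n] by (simp add: measure_gbox add_nonneg_pos)
      ultimately show ?thesis
        unfolding P_def by (metis measure_empty not_le)
    qed
    ultimately obtain n where n: "P n" "\<not> P (Suc n)"
      by (metis nat_induct)
    have "u z > l" if "z \<in> gbox x (R / 2 ^ n)" for z
    proof (rule ccontr)
      assume "\<not> u z > l"
      \<comment> \<open>By \<open>dens'\<close>, failure at the finer scale excludes values of at
        most \<open>l\<close> from its tripled box, which contains the whole box at scale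
        \<open>n\<close>; this puts \<open>N\<close> inside \<open>F\<close>.\<close>
      moreover have "R / 2 ^ n \<le> 3 * (R / 2 ^ Suc n)"
        using R by (simp add: field_simps)
      then have "z \<in> gbox x (3 * (R / 2 ^ Suc n))"
        using that gbox_mono \<rho>n by blast
      ultimately show False
        using dens' n(2) by (meson not_le)
    qed
    then have "N x (R / 2 ^ n) \<subseteq> F"
      using N[OF x\<Omega> \<rho>n, of n] by (auto simp: F_def)
    then show ?thesis
      using \<rho>n n(1) unfolding P_def by blast
  qed
  then obtain \<rho> where \<rho>: "\<And>x. x \<in> E \<Longrightarrow> 0 < \<rho> x \<and> \<rho> x \<le> R \<and> N x (\<rho> x) \<subseteq> F \<and>
     \<delta> * measure lebesgue (gbox x (\<rho> x)) \<le> measure lebesgue (N x (\<rho> x) - E)"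
    by metis
  have E\<Omega>: "E \<subseteq> \<Omega>"
    by (auto simp: E_def)
  have "measure lebesgue E \<le> 27 / \<delta> * measure lebesgue (F - E)"
  proof (rule ink_spots[OF mE bE mF \<delta>, of \<rho> "\<lambda>x. N x (\<rho> x)"])
    fix x assume x: "x \<in> E"
    note N' = N[of x "\<rho> x"] \<rho>[OF x]
    show "0 < \<rho> x" "N x (\<rho> x) \<in> lmeasurable" "N x (\<rho> x) \<subseteq> F \<inter> gbox x (\<rho> x)"
      "\<delta> * measure lebesgue (gbox x (\<rho> x)) \<le> measure lebesgue (N x (\<rho> x) - E)"
      using N' x E\<Omega> by blast+
  qed
  also have "measure lebesgue (F - E) = measure lebesgue F - measure lebesgue E"
    by (rule measurable_measure_Diff[OF mF fmeasurableD[OF mE] EF])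
  finally have "\<delta> * measure lebesgue E \<le> 27 * (measure lebesgue F - measure lebesgue E)"
    using \<delta> by (simp add: field_simps)
  then have "measure lebesgue E \<le> 27 / (27 + \<delta>) * measure lebesgue F"
    using \<delta> by (simp add: field_simps)
  then show ?thesis
    by (simp add: E_def F_def)
qed

section \<open>Placing the pole\<close>

text \<open>Moving from \<open>a\<close> towards \<open>b\<close> by \<open>h / 8\<close> leaves
  room for an interval of half-length \<open>h / 32\<close> on the same side of \<open>a\<close>.
  Overshooting \<open>b\<close> is harmless, as \<open>h \<le> 2 * W\<close>.\<close>

lemma shift_towards:
  fixes a b h W :: real
  assumes "\<bar>a - b\<bar> < W" "h \<le> 2 * W" "0 < h"
  obtains q where "\<bar>q - a\<bar> \<le> h / 2" "\<And>t. \<bar>t - q\<bar> < h / 32 \<Longrightarrow> \<bar>t - b\<bar> < W \<and> \<bar>t - a\<bar> < h"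
proof (cases "a \<le> b")
  case True
  show thesis
  proof (rule that[of "a + h / 8"])
    fix t assume t: "\<bar>t - (a + h / 8)\<bar> < h / 32"
    show "\<bar>t - b\<bar> < W \<and> \<bar>t - a\<bar> < h"
      using t True assms unfolding abs_less_iff by argo
  qed (use assms in simp)
next
  case False
  show thesis
  proof (rule that[of "a - h / 8"])
    fix t assume t: "\<bar>t - (a - h / 8)\<bar> < h / 32"
    show "\<bar>t - b\<bar> < W \<and> \<bar>t - a\<bar> < h"
      using t False assms unfolding abs_less_iff by argo
  qed (use assms in simp)
qed

text \<open>The pole is shifted from \<open>x\<close> towards \<open>y\<close>, so that its small box stays in the large one, and by
  one of two amounts, so that it avoids the degenerate line.\<close>

lemma pole_exists:
  fixes x y :: "real \<times> real"
  assumes x: "x \<in> gbox y R" and \<rho>: "0 < \<rho>" "\<rho> \<le> R"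
  defines "s \<equiv> \<bar>fst x\<bar> + \<rho>"
  obtains p q where "\<bar>p - fst x\<bar> \<le> \<rho> / 2" "s \<le> 13 * \<bar>p\<bar>" "\<bar>q - snd x\<bar> \<le> \<rho> * s / 2"
    "rect (p, q) (\<rho> / 32) (\<rho> * s / 32) \<subseteq> gbox y R \<inter> gbox x \<rho>"
proof -
  have s: "s \<ge> \<rho>" "\<rho> * s > 0"
    using \<rho> by (auto simp: s_def intro!: mult_pos_pos add_nonneg_pos)
  have xb: "\<bar>fst x - fst y\<bar> < R" "\<bar>snd x - snd y\<bar> < R * (\<bar>fst y\<bar> + R)"
    using x by (auto simp: mem_gbox)
  have "\<rho> * s \<le> R * (2 * (\<bar>fst y\<bar> + R))"
    using \<rho> xb(1) unfolding s_def by (intro mult_mono) auto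
  then have W: "\<rho> * s \<le> 2 * (R * (\<bar>fst y\<bar> + R))"
    by (simp only: mult.left_commute)
  \<comment> \<open>The candidate shifts \<open>\<rho> / 8\<close> and \<open>3 * \<rho> / 8\<close>
    differ by \<open>\<rho> / 4\<close>, so at least one of them ends at distance at least
    \<open>\<rho> / 8\<close> from 0.\<close>
  have "\<exists>p. \<bar>p - fst x\<bar> \<le> 3 * \<rho> / 8 \<and> \<rho> \<le> 8 * \<bar>p\<bar> \<and>
     (\<forall>t. \<bar>t - p\<bar> < \<rho> / 32 \<longrightarrow> \<bar>t - fst y\<bar> < R)"
  proof (cases "fst x \<le> fst y")
    case True
    show ?thesis
    proof (cases "\<rho> \<le> 8 * \<bar>fst x + \<rho> / 8\<bar>")
      case far: True
      have "\<bar>t - fst y\<bar> < R" if "\<bar>t - (fst x + \<rho> / 8)\<bar> < \<rho> / 32" for t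
        using that True xb(1) \<rho> by linarith
      with far \<rho>(1) show ?thesis
        by (intro exI[of _ "fst x + \<rho> / 8"]) simp
    next
      case near: False
      then have "\<rho> \<le> 8 * \<bar>fst x + 3 * \<rho> / 8\<bar>"
        by (auto simp: abs_if field_simps split: if_splits)
      moreover have "\<bar>t - fst y\<bar> < R" if "\<bar>t - (fst x + 3 * \<rho> / 8)\<bar> < \<rho> / 32" for t
        using that True xb(1) \<rho> by linarith
      ultimately show ?thesis
        using \<rho>(1) by (intro exI[of _ "fst x + 3 * \<rho> / 8"]) simp
    qed
  next
    case False
    show ?thesis
    proof (cases "\<rho> \<le> 8 * \<bar>fst x - \<rho> / 8\<bar>")
      case far: True
      have "\<bar>t - fst y\<bar> < R" if "\<bar>t - (fst x - \<rho> / 8)\<bar> < \<rho> / 32" for t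
        using that False xb(1) \<rho> by linarith
      with far \<rho>(1) show ?thesis
        by (intro exI[of _ "fst x - \<rho> / 8"]) simp
    next
      case near: False
      then have "\<rho> \<le> 8 * \<bar>fst x - 3 * \<rho> / 8\<bar>"
        by (auto simp: abs_if field_simps split: if_splits)
      moreover have "\<bar>t - fst y\<bar> < R" if "\<bar>t - (fst x - 3 * \<rho> / 8)\<bar> < \<rho> / 32" for t
        using that False xb(1) \<rho> by linarith
      ultimately show ?thesis
        using \<rho>(1) by (intro exI[of _ "fst x - 3 * \<rho> / 8"]) simp
    qed
  qed
  then obtain p where p0: "\<bar>p - fst x\<bar> \<le> 3 * \<rho> / 8" "\<rho> \<le> 8 * \<bar>p\<bar>"
    "\<And>t. \<bar>t - p\<bar> < \<rho> / 32 \<Longrightarrow> \<bar>t - fst y\<bar> < R"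
    by blast
  have p: "\<bar>p - fst x\<bar> \<le> \<rho> / 2" "s \<le> 13 * \<bar>p\<bar>"
    "\<And>t. \<bar>t - p\<bar> < \<rho> / 32 \<Longrightarrow> \<bar>t - fst y\<bar> < R \<and> \<bar>t - fst x\<bar> < \<rho>"
  proof -
    show "\<bar>p - fst x\<bar> \<le> \<rho> / 2"
      using p0(1) \<rho>(1) by linarith
    \<comment> \<open>This gives \<open>s \<le> \<bar>p\<bar> + 11 * \<rho> / 8\<close>, hence at
      most \<open>12 * \<bar>p\<bar>\<close>.\<close>
    have "\<bar>fst x\<bar> \<le> \<bar>p\<bar> + \<bar>p - fst x\<bar>"
      by linarith
    then show "s \<le> 13 * \<bar>p\<bar>"
      using p0(1,2) \<rho>(1) unfolding s_def by linarith
    show "\<bar>t - fst y\<bar> < R \<and> \<bar>t - fst x\<bar> < \<rho>" if "\<bar>t - p\<bar> < \<rho> / 32" for t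
      using that p0(1) p0(3)[OF that] \<rho>(1) by linarith
  qed
  obtain q where q: "\<bar>q - snd x\<bar> \<le> \<rho> * s / 2"
    "\<And>t. \<bar>t - q\<bar> < \<rho> * s / 32 \<Longrightarrow> \<bar>t - snd y\<bar> < R * (\<bar>fst y\<bar> + R) \<and> \<bar>t - snd x\<bar> < \<rho> * s"
    using shift_towards[OF xb(2) W s(2)] by blast
  have "rect (p, q) (\<rho> / 32) (\<rho> * s / 32) \<subseteq> gbox y R \<inter> gbox x \<rho>"
  proof
    fix z assume "z \<in> rect (p, q) (\<rho> / 32) (\<rho> * s / 32)"
    then show "z \<in> gbox y R \<inter> gbox x \<rho>"
      using p(3)[of "fst z"] q(2)[of "snd z"] by (simp add: mem_rect mem_gbox s_def)
  qed
  then show thesis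
    by (rule that[OF p(1,2) q(1)])
qed

section \<open>Comparison of boxes with balls\<close>

text \<open>Squaring \<open>S < r + \<sigma>\<close> removes the root and leaves
  \<open>4 * D < r * (r + 2 * \<sigma>)\<close>; moreover
  \<open>\<sigma> \<le> 2 * \<bar>fst y\<bar> + r\<close>.\<close>

lemma gball_subset_gbox:
  assumes "r > 0"
  shows "gball y r \<subseteq> gbox y r"
proof
  fix x assume x: "x \<in> gball y r"
  define \<sigma> where "\<sigma> = sqrt ((fst x)\<^sup>2 + (fst y)\<^sup>2)"
  define D where "D = \<bar>snd x - snd y\<bar>"
  define S where "S = sqrt ((fst x)\<^sup>2 + (fst y)\<^sup>2 + 4 * D)"
  have d: "\<bar>fst x - fst y\<bar> + S - \<sigma> < r"
    using x by (simp add: gball_def d_tilde_def \<sigma>_def S_def D_def)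
  have S: "\<sigma> \<le> S" "S\<^sup>2 = \<sigma>\<^sup>2 + 4 * D" "\<sigma> \<ge> 0"
    by (auto simp: \<sigma>_def S_def D_def)
  have 1: "\<bar>fst x - fst y\<bar> < r" "S < r + \<sigma>"
    using d S by linarith+
  have "S\<^sup>2 < (r + \<sigma>)\<^sup>2"
    using 1 S by (intro power_strict_mono) auto
  then have 2: "4 * D < r * (r + 2 * \<sigma>)"
    using S(2) by (simp add: power2_eq_square algebra_simps)
  have "\<sigma> \<le> \<bar>fst x\<bar> + \<bar>fst y\<bar>"
    unfolding \<sigma>_def by (rule sqrt_sum_squares_le_sum_abs)
  then have "\<sigma> \<le> 2 * \<bar>fst y\<bar> + r"
    using 1 by linarith
  then have "r * (r + 2 * \<sigma>) \<le> r * (4 * (\<bar>fst y\<bar> + r))"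
    using assms by (intro mult_left_mono) auto
  moreover have "r * (4 * (\<bar>fst y\<bar> + r)) = 4 * (r * (\<bar>fst y\<bar> + r))"
    by (simp only: mult.left_commute)
  ultimately have "D < r * (\<bar>fst y\<bar> + r)"
    using 2 by linarith
  then show "x \<in> gbox y r"
    using 1 by (simp add: mem_gbox D_def)
qed

text \<open>The vertical bound completes a square, so the root grows by at most
  \<open>2 * r\<close>; the horizontal distance adds another \<open>r\<close>, whence the factor
  3.\<close>

lemma gbox_subset_gball:
  assumes "r > 0"
  shows "gbox y r \<subseteq> gball y (3 * r)"
proof
  fix x assume x: "x \<in> gbox y r"
  define \<sigma> where "\<sigma> = sqrt ((fst x)\<^sup>2 + (fst y)\<^sup>2)"
  define D where "D = \<bar>snd x - snd y\<bar>"
  have \<sigma>: "\<bar>fst y\<bar> \<le> \<sigma>" "\<sigma>\<^sup>2 = (fst x)\<^sup>2 + (fst y)\<^sup>2"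
    unfolding \<sigma>_def by (auto intro: real_le_rsqrt)
  have "D < r * (\<bar>fst y\<bar> + r)"
    using x by (simp add: mem_gbox D_def)
  also have "\<dots> \<le> r * (\<sigma> + r)"
    using assms \<sigma> by (intro mult_left_mono) auto
  finally have "(fst x)\<^sup>2 + (fst y)\<^sup>2 + 4 * D \<le> (\<sigma> + 2 * r)\<^sup>2"
    unfolding \<sigma>(2)[symmetric] by (simp add: power2_eq_square algebra_simps)
  then have "sqrt ((fst x)\<^sup>2 + (fst y)\<^sup>2 + 4 * D) \<le> \<sigma> + 2 * r"
    using assms \<sigma> by (intro real_le_lsqrt) (auto intro: order_trans[OF abs_ge_zero] simp: D_def)
  moreover have "\<bar>fst x - fst y\<bar> < r"
    using x by (simp add: mem_gbox)
  ultimately show "x \<in> gball y (3 * r)"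
    by (simp add: gball_def d_tilde_def \<sigma>_def D_def)
qed

lemma open_gball: "open (gball y r)"
  unfolding gball_def d_tilde_def by (intro open_Collect_less continuous_intros)

lemma gball_mono: "r \<le> r' \<Longrightarrow> gball y r \<subseteq> gball y r'"
  by (auto simp: gball_def)

lemma lmeasurable_gball: "r > 0 \<Longrightarrow> gball y r \<in> lmeasurable"
  using bounded_subset[OF bounded_gbox gball_subset_gbox] open_gball lmeasurable_open by blast

section \<open>Uniform constants and iteration\<close>

text \<open>Choosing \<open>\<alpha>\<close> from the ellipticity constants alone makes
  \<open>T\<close> and \<open>\<delta>\<close> independent of the operator, the box and the level.
  The extra 4 in \<open>\<delta>\<close> comes from the area of \<open>gbox\<close>.\<close>

lemma density_estimate:
  fixes lam Lam :: real
  assumes lam: "0 < lam" "lam \<le> Lam"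
  obtains T \<delta> where "T > 1" "\<delta> > 0"
    "\<And>a11 a12 a22 u U x p q \<rho> l z. ellipticity_constants lam Lam a11 a12 a22 \<Longrightarrow> open U \<Longrightarrow>
      C2_on U u \<Longrightarrow> (\<And>z. z \<in> U \<Longrightarrow> u z \<ge> 0) \<Longrightarrow>
      (\<And>z. z \<in> U \<Longrightarrow> grushin_op a11 a12 a22 u z \<le> 0) \<Longrightarrow> \<rho> > 0 \<Longrightarrow>
      \<bar>p - fst x\<bar> \<le> \<rho> / 2 \<Longrightarrow> \<bar>fst x\<bar> + \<rho> \<le> 13 * \<bar>p\<bar> \<Longrightarrow>
      \<bar>q - snd x\<bar> \<le> \<rho> * (\<bar>fst x\<bar> + \<rho>) / 2 \<Longrightarrow>
      (\<And>z. \<bar>fst z - p\<bar> \<le> 16 * \<rho> \<Longrightarrow> \<bar>snd z - q\<bar> \<le> 16 * (\<rho> * (\<bar>fst x\<bar> + \<rho>)) \<Longrightarrow> z \<in> U) \<Longrightarrow>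
      l > 0 \<Longrightarrow> z \<in> gbox x (3 * \<rho>) \<Longrightarrow> u z \<le> l \<Longrightarrow>
      \<delta> * measure lebesgue (gbox x \<rho>)
        \<le> measure lebesgue ({z. u z \<le> T * l} \<inter> rect (p, q) (\<rho> / 32) (\<rho> * (\<bar>fst x\<bar> + \<rho>) / 32))"
proof -
  define \<alpha> where "\<alpha> = 10 ^ 9 * Lam / lam"
  define T where "T = 2 / (exp (- 128 * \<alpha>) - exp (- 256 * \<alpha>))"
  define \<delta> where "\<delta> = lam\<^sup>2 / (4 * 4096 * 676 * (580 * T * \<alpha> * Lam)\<^sup>2)"
  have Lam: "Lam > 0"
    using lam by simp
  have \<alpha>: "\<alpha> > 0" "\<alpha> * lam \<ge> 10 ^ 9 * Lam"
    using lam Lam by (auto simp: \<alpha>_def)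
  have gap: "exp (- 128 * \<alpha>) - exp (- 256 * \<alpha>) > 0" "exp (- 128 * \<alpha>) - exp (- 256 * \<alpha>) < 1"
  proof -
    show "exp (- 128 * \<alpha>) - exp (- 256 * \<alpha>) > 0"
      using \<alpha> by simp
    have "exp (- 128 * \<alpha>) < 1" "exp (- 256 * \<alpha>) > 0"
      using \<alpha> by simp_all
    then show "exp (- 128 * \<alpha>) - exp (- 256 * \<alpha>) < 1"
      by linarith
  qed
  have T: "T > 1"
    unfolding T_def pos_less_divide_eq[OF gap(1)] mult_1 using gap(2) by linarith
  have \<delta>: "\<delta> > 0"
    using lam Lam T \<alpha> by (simp add: \<delta>_def)
  show thesis
  proof (rule that[OF T \<delta>])
    fix a11 a12 a22 u :: "real \<times> real \<Rightarrow> real" and U x z and p q \<rho> l :: real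
    assume h: "ellipticity_constants lam Lam a11 a12 a22" "open U" "C2_on U u"
      "\<And>z. z \<in> U \<Longrightarrow> u z \<ge> 0" "\<And>z. z \<in> U \<Longrightarrow> grushin_op a11 a12 a22 u z \<le> 0" "\<rho> > 0"
      "\<bar>p - fst x\<bar> \<le> \<rho> / 2" "\<bar>fst x\<bar> + \<rho> \<le> 13 * \<bar>p\<bar>"
      "\<bar>q - snd x\<bar> \<le> \<rho> * (\<bar>fst x\<bar> + \<rho>) / 2"
      "\<And>z. \<bar>fst z - p\<bar> \<le> 16 * \<rho> \<Longrightarrow> \<bar>snd z - q\<bar> \<le> 16 * (\<rho> * (\<bar>fst x\<bar> + \<rho>)) \<Longrightarrow> z \<in> U"
      "l > 0" "z \<in> gbox x (3 * \<rho>)" "u z \<le> l"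
    have "\<delta> * measure lebesgue (gbox x \<rho>)
        = lam\<^sup>2 * \<rho>\<^sup>2 * (\<bar>fst x\<bar> + \<rho>) / (4096 * 676 * (580 * T * \<alpha> * Lam)\<^sup>2)"
      using h(6) by (simp add: measure_gbox \<delta>_def)
    also have "\<dots> \<le> measure lebesgue ({z. u z \<le> T * l} \<inter> rect (p, q) (\<rho> / 32) (\<rho> * (\<bar>fst x\<bar> + \<rho>) / 32))"
      by (rule level_set_lower_bound[OF lam \<alpha> T_def h(1-6) refl h(7-13)])
    finally show "\<delta> * measure lebesgue (gbox x \<rho>)
        \<le> measure lebesgue ({z. u z \<le> T * l} \<inter> rect (p, q) (\<rho> / 32) (\<rho> * (\<bar>fst x\<bar> + \<rho>) / 32))" .
  qed
qed

lemma decay_iterate: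
  fixes lam Lam :: real
  assumes lam: "0 < lam" "lam \<le> Lam"
  obtains T \<theta> where "T > 1" "0 < \<theta>" "\<theta> < 1"
    "\<And>a11 a12 a22 u y R l k. ellipticity_constants lam Lam a11 a12 a22 \<Longrightarrow> R > 0 \<Longrightarrow>
      C2_on (gball y (108 * R)) u \<Longrightarrow> (\<And>z. z \<in> gball y (108 * R) \<Longrightarrow> u z \<ge> 0) \<Longrightarrow>
      (\<And>z. z \<in> gball y (108 * R) \<Longrightarrow> grushin_op a11 a12 a22 u z \<le> 0) \<Longrightarrow> l > 0 \<Longrightarrow>
      (\<exists>z\<in>gball y (2 * R). u z \<le> l) \<Longrightarrow>
      measure lebesgue {z \<in> gbox y R. u z > T ^ k * l} \<le> \<theta> ^ k * measure lebesgue (gbox y R)"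
proof -
  obtain T \<delta> where T: "T > 1" and \<delta>: "\<delta> > 0" and dens:
    "\<And>a11 a12 a22 u U x p q \<rho> l z. ellipticity_constants lam Lam a11 a12 a22 \<Longrightarrow> open U \<Longrightarrow>
      C2_on U u \<Longrightarrow> (\<And>z. z \<in> U \<Longrightarrow> u z \<ge> 0) \<Longrightarrow>
      (\<And>z. z \<in> U \<Longrightarrow> grushin_op a11 a12 a22 u z \<le> 0) \<Longrightarrow> \<rho> > 0 \<Longrightarrow>
      \<bar>p - fst x\<bar> \<le> \<rho> / 2 \<Longrightarrow> \<bar>fst x\<bar> + \<rho> \<le> 13 * \<bar>p\<bar> \<Longrightarrow>
      \<bar>q - snd x\<bar> \<le> \<rho> * (\<bar>fst x\<bar> + \<rho>) / 2 \<Longrightarrow>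
      (\<And>z. \<bar>fst z - p\<bar> \<le> 16 * \<rho> \<Longrightarrow> \<bar>snd z - q\<bar> \<le> 16 * (\<rho> * (\<bar>fst x\<bar> + \<rho>)) \<Longrightarrow> z \<in> U) \<Longrightarrow>
      l > 0 \<Longrightarrow> z \<in> gbox x (3 * \<rho>) \<Longrightarrow> u z \<le> l \<Longrightarrow>
      \<delta> * measure lebesgue (gbox x \<rho>)
        \<le> measure lebesgue ({z. u z \<le> T * l} \<inter> rect (p, q) (\<rho> / 32) (\<rho> * (\<bar>fst x\<bar> + \<rho>) / 32))"
    using density_estimate[OF lam] by blast
  define \<theta> where "\<theta> = 27 / (27 + \<delta>)"
  have \<theta>: "0 < \<theta>" "\<theta> < 1"
    using \<delta> by (auto simp: \<theta>_def)
  show thesis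
  proof (rule that[OF T \<theta>])
    fix a11 a12 a22 u :: "real \<times> real \<Rightarrow> real" and y :: "real \<times> real" and R l :: real and k :: nat
    assume ell: "ellipticity_constants lam Lam a11 a12 a22" and R: "R > 0"
      and C2: "C2_on (gball y (108 * R)) u" and u0: "\<And>z. z \<in> gball y (108 * R) \<Longrightarrow> u z \<ge> 0"
      and Lu: "\<And>z. z \<in> gball y (108 * R) \<Longrightarrow> grushin_op a11 a12 a22 u z \<le> 0" and l: "l > 0"
      and start: "\<exists>z\<in>gball y (2 * R). u z \<le> l"
    \<comment> \<open>Naming the two products makes all vertical bounds linear;
      \<open>gbox y (36 * R)\<close> has half-height \<open>36 * W + 1296 * V\<close>, with ample
      room for every barrier used.\<close>
    define W where "W = R * \<bar>fst y\<bar>"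
    define V where "V = R * R"
    have WV: "W \<ge> 0" "V > 0"
      using R by (auto simp: W_def V_def)
    have big: "z \<in> gball y (108 * R)"
      if "\<bar>fst z - fst y\<bar> < 36 * R" "\<bar>snd z - snd y\<bar> < 36 * W + 1296 * V" for z
    proof -
      have "z \<in> gbox y (36 * R)"
        using that by (simp add: mem_gbox W_def V_def algebra_simps)
      then show ?thesis
        using gbox_subset_gball[of "36 * R" y] R by (auto simp: mult.assoc)
    qed
    \<comment> \<open>\<open>N\<close> is the small box around the pole. It is chosen before the
      level, so one choice serves all steps of the iteration.\<close>
    have pole: "\<exists>N. N \<in> lmeasurable \<and> N \<subseteq> gbox y R \<inter> gbox x \<rho> \<and>
       (\<forall>l z. l > 0 \<longrightarrow> z \<in> gbox x (3 * \<rho>) \<longrightarrow> u z \<le> l \<longrightarrow>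
         \<delta> * measure lebesgue (gbox x \<rho>) \<le> measure lebesgue ({z. u z \<le> T * l} \<inter> N))"
      if x: "x \<in> gbox y R" and \<rho>: "0 < \<rho>" "\<rho> \<le> R" for x \<rho>
    proof -
      obtain p q where p: "\<bar>p - fst x\<bar> \<le> \<rho> / 2" "\<bar>fst x\<bar> + \<rho> \<le> 13 * \<bar>p\<bar>"
        and q: "\<bar>q - snd x\<bar> \<le> \<rho> * (\<bar>fst x\<bar> + \<rho>) / 2"
        and sub: "rect (p, q) (\<rho> / 32) (\<rho> * (\<bar>fst x\<bar> + \<rho>) / 32) \<subseteq> gbox y R \<inter> gbox x \<rho>"
        using pole_exists[OF x \<rho>] by blast
      have xb: "\<bar>fst x - fst y\<bar> < R" "\<bar>snd x - snd y\<bar> < W + V"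
        using x by (auto simp: mem_gbox W_def V_def algebra_simps)
      have "\<rho> * (\<bar>fst x\<bar> + \<rho>) \<le> R * (\<bar>fst y\<bar> + 2 * R)"
        using \<rho> xb(1) by (intro mult_mono) auto
      then have rs: "\<rho> * (\<bar>fst x\<bar> + \<rho>) \<le> W + 2 * V"
        by (simp add: W_def V_def algebra_simps)
      have D: "z \<in> gball y (108 * R)"
        if z: "\<bar>fst z - p\<bar> \<le> 16 * \<rho>" "\<bar>snd z - q\<bar> \<le> 16 * (\<rho> * (\<bar>fst x\<bar> + \<rho>))" for z
      proof (rule big)
        have "\<bar>fst z - fst y\<bar> \<le> \<bar>fst z - p\<bar> + \<bar>p - fst x\<bar> + \<bar>fst x - fst y\<bar>"
          by linarith
        then show "\<bar>fst z - fst y\<bar> < 36 * R"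
          using z(1) p(1) xb(1) \<rho> by linarith
        have "\<bar>snd z - snd y\<bar> \<le> \<bar>snd z - q\<bar> + \<bar>q - snd x\<bar> + \<bar>snd x - snd y\<bar>"
          by linarith
        then show "\<bar>snd z - snd y\<bar> < 36 * W + 1296 * V"
          using z(2) q xb(2) rs WV by linarith
      qed
      show ?thesis
      proof (intro exI[of _ "rect (p, q) (\<rho> / 32) (\<rho> * (\<bar>fst x\<bar> + \<rho>) / 32)"] conjI allI impI)
        fix l z assume lz: "l > 0" "z \<in> gbox x (3 * \<rho>)" "u z \<le> l"
        show "\<delta> * measure lebesgue (gbox x \<rho>) \<le> measure lebesgue ({z. u z \<le> T * l} \<inter>
            rect (p, q) (\<rho> / 32) (\<rho> * (\<bar>fst x\<bar> + \<rho>) / 32))"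
          by (rule dens[OF ell open_gball C2 u0 Lu \<rho>(1) p q D lz])
      qed (rule lmeasurable_rect sub)+
    qed
    then obtain N where N: "\<And>x \<rho>. x \<in> gbox y R \<Longrightarrow> 0 < \<rho> \<Longrightarrow> \<rho> \<le> R \<Longrightarrow>
       N x \<rho> \<in> lmeasurable \<and> N x \<rho> \<subseteq> gbox y R \<inter> gbox x \<rho> \<and>
       (\<forall>l z. l > 0 \<longrightarrow> z \<in> gbox x (3 * \<rho>) \<longrightarrow> u z \<le> l \<longrightarrow>
         \<delta> * measure lebesgue (gbox x \<rho>) \<le> measure lebesgue ({z. u z \<le> T * l} \<inter> N x \<rho>))"
      by metis
    have sub: "gbox y R \<subseteq> gball y (108 * R)"
      using gbox_subset_gball[OF R, of y] gball_mono[of "3 * R" "108 * R" y] R by auto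
    have cont: "continuous_on (gbox y R) u"
      using C1_on_imp_continuous_on[OF _ open_gball, of y "108 * R" u] C2 sub continuous_on_subset
      unfolding C2_on_def by blast
    \<comment> \<open>A single point with \<open>u z \<le> l\<close> in the ball of radius
      \<open>2 * R\<close> is visible, at the top scale, from the tripled box of every
      \<open>x\<close>.\<close>
    have near: "\<exists>z\<in>gbox x (3 * R). u z \<le> l" if x: "x \<in> gbox y R" for x
    proof -
      obtain z where z: "z \<in> gball y (2 * R)" "u z \<le> l"
        using start by blast
      then have "z \<in> gbox y (2 * R)"
        using gball_subset_gbox[of "2 * R" y] R by auto
      then have zb: "\<bar>fst z - fst y\<bar> < 2 * R" "\<bar>snd z - snd y\<bar> < 2 * W + 4 * V"
        by (auto simp: mem_gbox W_def V_def algebra_simps)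
      have xb: "\<bar>fst x - fst y\<bar> < R" "\<bar>snd x - snd y\<bar> < W + V"
        using x by (auto simp: mem_gbox W_def V_def algebra_simps)
      have "R * \<bar>fst y\<bar> \<le> R * (\<bar>fst x\<bar> + R)"
        using xb(1) R by (intro mult_left_mono) auto
      then have "W \<le> R * \<bar>fst x\<bar> + V"
        by (simp add: W_def V_def algebra_simps)
      then have "\<bar>snd z - snd x\<bar> < 3 * (R * \<bar>fst x\<bar>) + 9 * V"
        using zb(2) xb(2) WV by linarith
      moreover have "\<bar>fst z - fst x\<bar> < 3 * R"
        using zb(1) xb(1) by linarith
      ultimately have "z \<in> gbox x (3 * R)"
        by (simp add: mem_gbox V_def algebra_simps)
      then show ?thesis
        using z(2) by blast
    qed
    show "measure lebesgue {z \<in> gbox y R. u z > T ^ k * l} \<le> \<theta> ^ k * measure lebesgue (gbox y R)"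
    proof (induction k)
      case 0
      have "open {z \<in> gbox y R. l < u z}"
      proof -
        have "{z \<in> gbox y R. l < u z} = gbox y R \<inter> u -` {l<..}"
          by auto
        then show ?thesis
          using continuous_open_preimage[OF cont open_gbox open_greaterThan] by simp
      qed
      then have "{z \<in> gbox y R. l < u z} \<in> sets lebesgue"
        by (simp add: borel_open)
      then have "measure lebesgue {z \<in> gbox y R. l < u z} \<le> measure lebesgue (gbox y R)"
        by (intro measure_mono_fmeasurable) auto
      then show ?case by simp
    next
      case (Suc k)
      have Tk: "T ^ k \<ge> 1"
        using T by simp
      then have lk: "T ^ k * l > 0" "l \<le> T ^ k * l"
        using l by (auto simp: mult_le_cancel_right1)
      have "measure lebesgue {z \<in> gbox y R. u z > T * (T ^ k * l)}
          \<le> 27 / (27 + \<delta>) * measure lebesgue {z \<in> gbox y R. u z > T ^ k * l}"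
      proof (rule decay_step[OF R refl cont \<delta> less_imp_le[OF T] lk(1), of N])
        fix x :: "real \<times> real" and \<rho> :: real
        assume x: "x \<in> gbox y R" "0 < \<rho>" "\<rho> \<le> R"
        show "N x \<rho> \<in> lmeasurable \<and> N x \<rho> \<subseteq> gbox y R \<inter> gbox x \<rho>"
          using N[OF x] by blast
        fix z assume "z \<in> gbox x (3 * \<rho>)" "u z \<le> T ^ k * l"
        then show "\<delta> * measure lebesgue (gbox x \<rho>)
            \<le> measure lebesgue ({z. u z \<le> T * (T ^ k * l)} \<inter> N x \<rho>)"
          using N[OF x] lk(1) by blast
      next
        fix x assume "x \<in> gbox y R"
        then show "\<exists>z\<in>gbox x (3 * R). u z \<le> T ^ k * l"
          using near lk(2) order_trans by blast
      qed
      also have "\<dots> \<le> \<theta> * (\<theta> ^ k * measure lebesgue (gbox y R))"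
        unfolding \<theta>_def[symmetric] using Suc \<theta> by (intro mult_left_mono) auto
      finally show ?case
        by (simp add: mult.assoc)
    qed
  qed
qed

theorem corollary6p8:
  fixes lam Lam :: real
  assumes "0 < lam" and "lam \<le> Lam"
  shows "\<exists>\<eta> \<epsilon> M :: real. \<eta> > 2 \<and> 0 < \<epsilon> \<and> \<epsilon> < 1 \<and> M > 1 \<and>
    (\<forall>(a11 :: real \<times> real \<Rightarrow> real) a12 a22 (y :: real \<times> real) (r :: real)
       (u :: real \<times> real \<Rightarrow> real).
       ellipticity_constants lam Lam a11 a12 a22 \<longrightarrow> r > 0 \<longrightarrow>
       C2_on (gball y (\<eta> * r)) u \<longrightarrow>
       continuous_on (closure (gball y (\<eta> * r))) u \<longrightarrow>
       (\<forall>x \<in> closure (gball y (\<eta> * r)). u x \<ge> 0) \<longrightarrow>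
       (\<forall>x \<in> gball y (\<eta> * r). grushin_op a11 a12 a22 u x \<le> 0) \<longrightarrow>
       (INF x \<in> gball y r \<inter> gball y (\<eta> * r). u x) \<le> 1 \<longrightarrow>
       (\<forall>k :: nat.
          measure lebesgue ({x. u x \<ge> M ^ k} \<inter> gball y (r / 2) \<inter> gball y (\<eta> * r))
            \<le> \<epsilon> ^ k * measure lebesgue (gball y (r / 2) \<inter> gball y (\<eta> * r))))"
proof -
  obtain T \<theta> where T: "T > 1" and \<theta>: "0 < \<theta>" "\<theta> < 1" and decay:
    "\<And>a11 a12 a22 u y R l k. ellipticity_constants lam Lam a11 a12 a22 \<Longrightarrow> R > 0 \<Longrightarrow>
      C2_on (gball y (108 * R)) u \<Longrightarrow> (\<And>z. z \<in> gball y (108 * R) \<Longrightarrow> u z \<ge> 0) \<Longrightarrow>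
      (\<And>z. z \<in> gball y (108 * R) \<Longrightarrow> grushin_op a11 a12 a22 u z \<le> 0) \<Longrightarrow> l > 0 \<Longrightarrow>
      (\<exists>z\<in>gball y (2 * R). u z \<le> l) \<Longrightarrow>
      measure lebesgue {z \<in> gbox y R. u z > T ^ k * l} \<le> \<theta> ^ k * measure lebesgue (gbox y R)"
    using decay_iterate[OF assms] by blast
  \<comment> \<open>One power of \<open>M\<close> stands for \<open>j\<close> decay steps, enough to
    beat the factor 27 lost between box and ball.\<close>
  obtain j where j: "\<theta> ^ j < 1 / 27"
    using real_arch_pow_inv[of "1 / 27" \<theta>] \<theta> by auto
  define M where "M = 3 * T ^ j"
  define \<epsilon> where "\<epsilon> = 27 * \<theta> ^ j"
  have \<epsilon>: "0 < \<epsilon>" "\<epsilon> < 1"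
    using j \<theta> by (auto simp: \<epsilon>_def)
  have "T ^ j \<ge> 1"
    using T by simp
  then have M: "M > 1"
    unfolding M_def by linarith
  have main: "measure lebesgue ({x. u x \<ge> M ^ k} \<inter> gball y (r / 2) \<inter> gball y (54 * r))
      \<le> \<epsilon> ^ k * measure lebesgue (gball y (r / 2) \<inter> gball y (54 * r))"
    if ell: "ellipticity_constants lam Lam a11 a12 a22" and r: "r > 0"
      and C2: "C2_on (gball y (54 * r)) u"
      and u0: "\<forall>x \<in> closure (gball y (54 * r)). u x \<ge> 0"
      and Lu: "\<forall>x \<in> gball y (54 * r). grushin_op a11 a12 a22 u x \<le> 0"
      and inf: "(INF x \<in> gball y r \<inter> gball y (54 * r). u x) \<le> 1"
    for a11 a12 a22 u :: "real \<times> real \<Rightarrow> real" and y r and k :: nat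
  proof -
    have u0': "u x \<ge> 0" if "x \<in> gball y (54 * r)" for x
      using u0 that closure_subset by blast
    have eq: "gball y (r / 2) \<inter> gball y (54 * r) = gball y (r / 2)"
      "gball y r \<inter> gball y (54 * r) = gball y r"
      using gball_mono[of "r / 2" "54 * r" y] gball_mono[of r "54 * r" y] r by auto
    \<comment> \<open>Nonemptiness and a lower bound give the real infimum its meaning. The level is
      2 because the value 1 need not be attained.\<close>
    have "y \<in> gball y r"
      using r by (simp add: gball_def d_tilde_def)
    moreover have "bdd_below (u ` gball y r)"
      using u0' eq(2) by (intro bdd_belowI2[of _ 0]) blast
    moreover have "(INF x \<in> gball y r. u x) < 2"
      using inf eq(2) by simp
    ultimately obtain z where z: "z \<in> gball y r" "u z < 2"
      using cINF_less_iff[of "gball y r" u 2] by blast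
    \<comment> \<open>Then \<open>2 * R\<close> is \<open>r\<close> and \<open>108 * R\<close> is
      \<open>54 * r\<close>, which explains the choice of 54 for \<open>\<eta>\<close>.\<close>
    define R where "R = r / 2"
    have R: "R > 0" "gball y (54 * r) = gball y (108 * R)" "gball y r = gball y (2 * R)"
      using r by (simp_all add: R_def)
    have level: "measure lebesgue {z \<in> gbox y R. u z > T ^ (j * k) * 2}
        \<le> \<theta> ^ (j * k) * measure lebesgue (gbox y R)"
    proof (rule decay[OF ell R(1)])
      show "\<exists>z\<in>gball y (2 * R). u z \<le> 2"
        using z R(3) by force
    qed (use C2 u0' Lu R(2) in auto)
    define A where "A = {x. u x \<ge> M ^ k} \<inter> gball y R"
    have gR: "gball y R \<in> lmeasurable"
      by (rule lmeasurable_gball[OF R(1)])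
    have contA: "continuous_on (gball y R) u"
      using C1_on_imp_continuous_on[OF _ open_gball, of y "54 * r" u] C2 eq(1) continuous_on_subset
      unfolding C2_on_def R_def by blast
    have mA: "A \<in> lmeasurable"
    proof -
      have "continuous_on (gball y R) (\<lambda>x. - u x)"
        using contA by (intro continuous_intros)
      from lmeasurable_sublevel[OF this gR, of "- (M ^ k)"] show ?thesis
        by (simp add: A_def)
    qed
    have "measure lebesgue A \<le> \<epsilon> ^ k * measure lebesgue (gball y R)"
    proof (cases "k = 0")
      case True
      then show ?thesis
        using mA gR by (auto simp: A_def intro!: measure_mono_fmeasurable fmeasurableD)
    next
      case False
      have "M ^ k = 3 ^ k * T ^ (j * k)"
        by (simp add: M_def power_mult_distrib power_mult)
      \<comment> \<open>The factor 3 in \<open>M\<close> lifts \<open>M ^ k\<close> above the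
        starting level 2; this needs \<open>k\<close> positive, hence the separate case 0.\<close>
      moreover have "(3::real) ^ 1 \<le> 3 ^ k"
        using False by (intro power_increasing) auto
      then have "2 * T ^ (j * k) < 3 ^ k * T ^ (j * k)"
        using T by (intro mult_strict_right_mono) auto
      ultimately have MT: "T ^ (j * k) * 2 < M ^ k"
        by simp
      have "measure lebesgue A \<le> measure lebesgue {z \<in> gbox y R. u z > T ^ (j * k) * 2}"
      proof (rule measure_mono_fmeasurable)
        show "A \<subseteq> {z \<in> gbox y R. u z > T ^ (j * k) * 2}"
          using MT gball_subset_gbox[OF R(1), of y] by (force simp: A_def)
        show "A \<in> sets lebesgue"
          using mA by (rule fmeasurableD)
        have sub: "gbox y R \<subseteq> gball y (54 * r)"
          using gbox_subset_gball[OF R(1), of y] gball_mono[of "3 * R" "54 * r" y] r by (auto simp: R_def)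
        have "continuous_on (gbox y R) u"
          using C1_on_imp_continuous_on[OF _ open_gball, of y "54 * r" u] C2 sub continuous_on_subset
          unfolding C2_on_def by blast
        from lmeasurable_sublevel[OF this lmeasurable_gbox, of "T ^ (j * k) * 2"]
        have "gbox y R - ({z. u z \<le> T ^ (j * k) * 2} \<inter> gbox y R) \<in> lmeasurable"
          by (intro fmeasurable_Diff) (auto intro: fmeasurableD)
        moreover have "gbox y R - ({z. u z \<le> T ^ (j * k) * 2} \<inter> gbox y R)
            = {z \<in> gbox y R. u z > T ^ (j * k) * 2}"
          by auto
        ultimately show "{z \<in> gbox y R. u z > T ^ (j * k) * 2} \<in> lmeasurable"
          by simp
      qed
      also note level
      \<comment> \<open>The box of radius \<open>R / 3\<close> fits into the ball of radius
        \<open>R\<close>. The resulting factor 27 is at most \<open>27 ^ k\<close> and disappears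
        into \<open>\<epsilon> ^ k\<close>.\<close>
      also have "measure lebesgue (gbox y R) \<le> 27 * measure lebesgue (gbox y (R / 3))"
        using measure_gbox_triple[of "R / 3" y] R(1) by simp
      also have "measure lebesgue (gbox y (R / 3)) \<le> measure lebesgue (gball y R)"
        using gbox_subset_gball[of "R / 3" y] R(1) gR by (intro measure_mono_fmeasurable fmeasurableD) auto
      also have "\<theta> ^ (j * k) * (27 * measure lebesgue (gball y R))
          \<le> (27 ^ k * (\<theta> ^ j) ^ k) * measure lebesgue (gball y R)"
      proof -
        have "(27::real) ^ 1 \<le> 27 ^ k"
          using False by (intro power_increasing) auto
        then have "\<theta> ^ (j * k) * 27 \<le> \<theta> ^ (j * k) * 27 ^ k"
          using \<theta> by (intro mult_left_mono) auto
        then have "\<theta> ^ (j * k) * 27 * measure lebesgue (gball y R)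
            \<le> \<theta> ^ (j * k) * 27 ^ k * measure lebesgue (gball y R)"
          by (intro mult_right_mono) auto
        then show ?thesis
          by (simp add: power_mult mult_ac)
      qed
      also have "27 ^ k * (\<theta> ^ j) ^ k = \<epsilon> ^ k"
        by (simp add: \<epsilon>_def power_mult_distrib)
      finally show ?thesis
        using \<theta> by simp
    qed
    then show ?thesis
      unfolding Int_assoc eq(1) by (simp add: A_def R_def)
  qed
  show ?thesis
    by (rule exI[of _ 54], rule exI[of _ \<epsilon>], rule exI[of _ M]) (use \<epsilon> M main in simp)
qed

end
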